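(* Consider the game with shared inequality constraint set $X=X^i$ described in the context, let Assumptions 1 and 2 (as stated in the context) hold, and let the graph $\mathcal G$ be undirected and connected. Let $\rho\in[1,2)$, let $\{\mu_k\}$ be a nonnegative sequence with $\sum_{k=1}^\infty\mu_k<\infty$, and let the parameters $R_i\in\mathbf R^{n_i\times n_i}$, $H_i\in\mathbf R^{m\times m}$ ($i\in\mathcal N$) and $W_l\in\mathbf R^{m\times m}$ ($l=1,\dots,M$) be symmetric positive definite and such that the matrix $$\Phi^i=\begin{pmatrix}R&0&-\Lambda^T\\0&W^{-1}&-\bar V^T\\-\Lambda&-\bar V&H^{-1}\end{pmatrix}$$ is positive definite. Then any sequence $col(\mathbf x_k,\mathbf Z_k,\bar\lambda_k)$ generated by Algorithm 2 (described in the context) converges to some $col(\mathbf x^*,\mathbf Z^*,\bar\lambda^* )\in zer\,\mathfrak M^i$. Furthermore, $\mathbf x^*$ is a variational GNE of the game with $X=X^i$, and $\bar\lambda^*=\mathbf 1_N\otimes\lambda^*$ for some $\lambda^*\in\mathbf R^m_+$.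
   Context: Notation. $col(\cdot)$ is the stacked column vector, $diag\{\cdot\}$ the block diagonal matrix, $\|x\|_G^2=x^TGx$ for symmetric $G$, $\|\cdot\|$ the Euclidean norm, $\otimes$ the Kronecker product, $\mathbf 1_N$ the all-ones vector, $\mathbf R^m_+$ the nonnegative orthant; vector inequalities are componentwise. For a closed convex set $\Omega$, $N_\Omega(x)=\{v:\langle v,y-x\rangle\le0\ \forall y\in\Omega\}$ for $x\in\Omega$ (empty otherwise), and for symmetric positive definite $G$, $P^G_\Omega(x)=\arg\min_{y\in\Omega}\frac12\|x-y\|_G^2$. For a set-valued operator $\mathfrak A$, $zer\,\mathfrak A=\{x:\mathbf 0\in\mathfrak Ax\}$. "l.s.c. function" means lower semicontinuous convex function; its subdifferential at $x\in dom f$ is $\partial f(x)=\{g:f(y)\ge f(x)+\langle g,y-x\rangle\ \forall y\in dom f\}$. Game. Players $\mathcal N=\{1,\dots,N\}$; player $i$ chooses $x_i\in\Omega_i\subset\mathbf R^{n_i}$; $n=\sum_in_i$, $\mathbf x=col(x_1,\dots,x_N)\in\mathbf R^n$, $\mathbf x_{-i}$ is the profile of all players except $i$, $\bar\Omega=\prod_{i=1}^N\Omega_i$. Player $i$ has objective $f_i(x_i,\mathbf x_{-i}):\bar\Omega\to\mathbf R$, $A_i\in\mathbf R^{m\times n_i}$, $b_i\in\mathbf R^m$. The shared set is $X=X^i:=\bar\Omega\cap\{\mathbf x:\sum_{i=1}^NA_ix_i\le\sum_{i=1}^Nb_i\}$, and $X_i(\mathbf x_{-i})=\{x_i\in\Omega_i:(x_i,\mathbf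 x_{-i})\in X\}$. Player $i$ minimizes $f_i(x_i,\mathbf x_{-i})$ over $x_i\in X_i(\mathbf x_{-i})$. A generalized Nash equilibrium (GNE) is $\mathbf x^*$ with $x_i^*\in\arg\min\{f_i(x_i,\mathbf x^*_{-i}):x_i\in X_i(\mathbf x^*_{-i})\}$ for all $i$. With $\partial_if_i(x_i,\mathbf x_{-i})$ the subdifferential in $x_i$, the pseudo-subdifferential is $\partial F(\mathbf x)=\prod_{i=1}^N\partial_if_i(x_i,\mathbf x_{-i})$. The generalized variational inequality (GVI) is: find $\mathbf x^*\in X$ for which there is $l^*\in\partial F(\mathbf x^* )$ with $\langle l^*,\mathbf x-\mathbf x^*\rangle\ge0$ for all $\mathbf x\in X$. Any solution of the GVI is a GNE; such a solution is called a variational GNE. Assumption 1. For each $i$, $f_i(\cdot,\mathbf x_{-i})$ is a proper l.s.c. (convex) function for every fixed $\mathbf x_{-i}$; $\partial F$ is maximally monotone; each $\Omega_i$ is closed convex with nonempty interior; $X^i$ has nonempty interior; $X_i(\mathbf x_{-i})$ has nonempty interior for every $\mathbf x_{-i}\in\prod_{j\ne i}\Omega_j$. Assumption 2. The GVI has at least one solution, i.e. the game has at least one variational GNE. Graph. $\mathcal G=(\mathcal N,\mathcal E)$ is a connected undirected graph with $M$ edges $e_1,\dots,e_M$, each given an arbitrary orientation $i\to j$. $\mathcal E_i^{in}$ (resp. $\mathcal E_i^{out}$) is the set of edges with target (resp. start) $i$, $\mathcal E_i=\mathcal E_i^{in}\cup\mathcal E_i^{out}$. The incidence matrix $V\in\mathbf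 R^{N\times M}$ has $V_{il}=1$ if $e_l\in\mathcal E_i^{in}$, $-1$ if $e_l\in\mathcal E_i^{out}$, $0$ otherwise. Compact notation. $\lambda_i\in\mathbf R^m$ is the local multiplier of player $i$, $z_l\in\mathbf R^m$ the variable of edge $e_l$; $\bar\lambda=col(\lambda_1,\dots,\lambda_N)$, $\mathbf Z=col(z_1,\dots,z_M)$, $R=diag\{R_1,\dots,R_N\}$, $H=diag\{H_1,\dots,H_N\}$, $W=diag\{W_1,\dots,W_M\}$, $\bar V=V\otimes I_m$, $\Lambda=diag\{A_1,\dots,A_N\}$, $\bar b=col(b_1,\dots,b_N)$. Algorithm 2. From arbitrary initial $\mathbf x_0,\mathbf Z_0,\bar\lambda_0$, for $k=0,1,\dots$: Step 1a: let $\hat{\mathbf x}_k$ be the (unique) Nash equilibrium of the subgame in which player $i$ minimizes over $x_i\in\Omega_i$ the function $\tilde f_i(x_i,\mathbf x_{-i})=f_i(x_i,\mathbf x_{-i})+\frac12\|x_i-x_{i,k}\|^2_{R_i}+\lambda_{i,k}^TA_ix_i$; choose any $\tilde{\mathbf x}_k=col(\tilde x_{1,k},\dots,\tilde x_{N,k})$ with $\|\tilde{\mathbf x}_k-\hat{\mathbf x}_k\|\le\mu_k$; set $x_{i,k+1}=x_{i,k}+\rho(\tilde x_{i,k}-x_{i,k})$. Step 1b: for each edge $e_l=i\to j$ set $\tilde z_{l,k}=z_{l,k}-W_l(\lambda_{j,k}-\lambda_{i,k})$ and $z_{l,k+1}=z_{l,k}+\rho(\tilde z_{l,k}-z_{l,k})$.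 Step 2: for each $i$, $$\tilde\lambda_{i,k}=P^{H_i^{-1}}_{\mathbf R^m_+}\Big[\lambda_{i,k}+H_i\Big(A_i(2\tilde x_{i,k}-x_{i,k})+\sum_{l\in\mathcal E_i}V_{il}(2\tilde z_{l,k}-z_{l,k})-b_i\Big)\Big],\quad \lambda_{i,k+1}=\lambda_{i,k}+\rho(\tilde\lambda_{i,k}-\lambda_{i,k}).$$ Operator. $$\mathfrak M^i:\begin{pmatrix}\mathbf x\\ \mathbf Z\\ \bar\lambda\end{pmatrix}\mapsto\begin{pmatrix}\Lambda^T\bar\lambda+(N_{\bar\Omega}+\partial F)\mathbf x\\ \bar V^T\bar\lambda\\ -\Lambda\mathbf x-\bar V\mathbf Z+\bar b+N_{\mathbf R^{mN}_+}(\bar\lambda)\end{pmatrix}.$$ *)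

theory Defs
  imports "HOL-Analysis.Analysis" "Graph_Theory.Graph_Theory"
begin

section \<open>Convex analysis and monotone operators\<close>

definition normal_cone :: "'a::real_inner set \<Rightarrow> 'a \<Rightarrow> 'a set" where
  "normal_cone C x = (if x \<in> C then {v. \<forall>y\<in>C. v \<bullet> (y - x) \<le> 0} else {})"

definition zer :: "('a::zero \<Rightarrow> 'b::zero set) \<Rightarrow> 'a set" where
  "zer T = {x. 0 \<in> T x}"

definition monotone_operator :: "('a::real_inner \<Rightarrow> 'a set) \<Rightarrow> bool" where
  "monotone_operator T \<longleftrightarrow> (\<forall>x y. \<forall>u\<in>T x. \<forall>v\<in>T y. 0 \<le> (u - v) \<bullet> (x - y))"

definition maximally_monotone :: "('a::real_inner \<Rightarrow> 'a set) \<Rightarrow> bool" where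
  "maximally_monotone T \<longleftrightarrow> monotone_operator T \<and>
     (\<forall>S. monotone_operator S \<and> (\<forall>x. T x \<subseteq> S x) \<longrightarrow> S = T)"

definition edom :: "('a \<Rightarrow> ereal) \<Rightarrow> 'a set" where
  "edom h = {x. h x < \<infinity>}"

definition proper_function :: "('a \<Rightarrow> ereal) \<Rightarrow> bool" where
  "proper_function h \<longleftrightarrow> edom h \<noteq> {} \<and> (\<forall>x. h x \<noteq> - \<infinity>)"

definition lsc_function :: "('a::topological_space \<Rightarrow> ereal) \<Rightarrow> bool" where
  "lsc_function h \<longleftrightarrow> (\<forall>x. h x \<le> Liminf (at x) h)"

definition convex_function :: "('a::real_vector \<Rightarrow> ereal) \<Rightarrow> bool" where
  "convex_function h \<longleftrightarrow> convex {(x, t::real). h x \<le> ereal t}"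

definition subdifferential :: "('a::real_inner \<Rightarrow> ereal) \<Rightarrow> 'a \<Rightarrow> 'a set" where
  "subdifferential h x =
     (if x \<in> edom h then {g. \<forall>y\<in>edom h. h y \<ge> h x + ereal (g \<bullet> (y - x))} else {})"


section \<open>Matrices and stacked vectors\<close>

text \<open>A real matrix, restricted to a subspace \<open>S\<close>, is symmetric positive definite.\<close>

definition posdef_on :: "(real^'n) set \<Rightarrow> real^'n^'n \<Rightarrow> bool" where
  "posdef_on S P \<longleftrightarrow> (\<forall>u\<in>S. \<forall>v\<in>S. u \<bullet> (P *v v) = (P *v u) \<bullet> v) \<and>
     (\<forall>v\<in>S. v \<noteq> 0 \<longrightarrow> 0 < v \<bullet> (P *v v))"

definition sqnorm :: "real^'n^'n \<Rightarrow> real^'n \<Rightarrow> real" where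
  "sqnorm P v = v \<bullet> (P *v v)"

definition projection :: "real^'n^'n \<Rightarrow> (real^'n) set \<Rightarrow> real^'n \<Rightarrow> real^'n" where
  "projection P C v = arg_min (\<lambda>y. 1/2 * sqnorm P (v - y)) (\<lambda>y. y \<in> C)"

definition orthant :: "(real^'n) set" where
  "orthant = {v. 0 \<le> v}"

definition col :: "('i::finite \<Rightarrow> real^'m) \<Rightarrow> real^('i \<times> 'm)" where
  "col u = (\<chi> q. u (fst q) $ snd q)"

definition blkdiag :: "('i::finite \<Rightarrow> real^'m^'m) \<Rightarrow> real^('i \<times> 'm)^('i \<times> 'm)" where
  "blkdiag B = (\<chi> p q. if fst p = fst q then B (fst p) $ snd p $ snd q else 0)"

definition kron :: "real^'b^'a \<Rightarrow> real^'d^'c \<Rightarrow> real^('b \<times> 'd)^('a \<times> 'c)" where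
  "kron P Q = (\<chi> p q. P $ fst p $ fst q * Q $ snd p $ snd q)"

definition kron_vec :: "real^'a \<Rightarrow> real^'c \<Rightarrow> real^('a \<times> 'c)" where
  "kron_vec u v = (\<chi> q. u $ fst q * v $ snd q)"


section \<open>The game\<close>

text \<open>
  The players are the elements of the finite type \<open>'p\<close>.  The decision profile
  is a vector of \<open>real^'c\<close>, and \<open>owner\<close> says which player controls which scalar
  coordinate.  So \<open>n\<^sub>i\<close> is the number of coordinates owned by \<open>i\<close>, the numbers \<open>n\<^sub>i\<close>
  are arbitrary, and their sum is the dimension of \<open>real^'c\<close>.  The space of
  decisions of player \<open>i\<close> is identified with the coordinate subspace \<open>pspace\<close>.

  \<open>cost i\<close> is only meaningful on the product of the strategy sets, and
  only those columns of \<open>cmat i\<close> that are owned by \<open>i\<close> form the matrix \<open>A\<^sub>i\<close>;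
  no definition below depends on the other values.
\<close>

record ('p, 'c, 'm) game =
  owner :: "'c::finite \<Rightarrow> 'p::finite"
  strat :: "'p \<Rightarrow> (real^'c) set"
  cost :: "'p \<Rightarrow> real^'c \<Rightarrow> real"
  cmat :: "'p \<Rightarrow> real^'c^'m::finite"
  cvec :: "'p \<Rightarrow> real^'m"

definition pspace :: "('p::finite, 'c::finite, 'm::finite) game \<Rightarrow> 'p \<Rightarrow> (real^'c) set" where
  "pspace \<Gamma> i = {v. \<forall>c. owner \<Gamma> c \<noteq> i \<longrightarrow> v $ c = 0}"

text \<open>The component \<open>x\<^sub>i\<close> of a profile \<open>x\<close>.\<close>

definition own :: "('p::finite, 'c::finite, 'm::finite) game \<Rightarrow> 'p \<Rightarrow> real^'c \<Rightarrow> real^'c" where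
  "own \<Gamma> i x = (\<chi> c. if owner \<Gamma> c = i then x $ c else 0)"

text \<open>The profile \<open>(y, x\<^sub>-\<^sub>i)\<close>, in which player \<open>i\<close> plays \<open>y\<close> and the others play as in \<open>x\<close>.\<close>

definition deviate :: "('p::finite, 'c::finite, 'm::finite) game \<Rightarrow> 'p \<Rightarrow> real^'c \<Rightarrow> real^'c \<Rightarrow> real^'c" where
  "deviate \<Gamma> i y x = (\<chi> c. if owner \<Gamma> c = i then y $ c else x $ c)"

definition profiles :: "('p::finite, 'c::finite, 'm::finite) game \<Rightarrow> (real^'c) set" where
  "profiles \<Gamma> = {x. \<forall>i. own \<Gamma> i x \<in> strat \<Gamma> i}"

definition shared_set :: "('p::finite, 'c::finite, 'm::finite) game \<Rightarrow> (real^'c) set" where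
  "shared_set \<Gamma> = profiles \<Gamma> \<inter>
     {x. (\<Sum>i\<in>UNIV. cmat \<Gamma> i *v own \<Gamma> i x) \<le> (\<Sum>i\<in>UNIV. cvec \<Gamma> i)}"

definition feasible :: "('p::finite, 'c::finite, 'm::finite) game \<Rightarrow> 'p \<Rightarrow> real^'c \<Rightarrow> (real^'c) set" where
  "feasible \<Gamma> i x = {y \<in> strat \<Gamma> i. deviate \<Gamma> i y x \<in> shared_set \<Gamma>}"

text \<open>
  The function \<open>f\<^sub>i(\<cdot>, x\<^sub>-\<^sub>i)\<close> has domain \<open>strat \<Gamma> i\<close>; it is extended by \<open>\<infinity>\<close>.
\<close>

definition section_cost :: "('p::finite, 'c::finite, 'm::finite) game \<Rightarrow> 'p \<Rightarrow> real^'c \<Rightarrow> real^'c \<Rightarrow> ereal" where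
  "section_cost \<Gamma> i x y =
     (if y \<in> strat \<Gamma> i then ereal (cost \<Gamma> i (deviate \<Gamma> i y x)) else \<infinity>)"

definition partial_subdiff :: "('p::finite, 'c::finite, 'm::finite) game \<Rightarrow> 'p \<Rightarrow> real^'c \<Rightarrow> (real^'c) set" where
  "partial_subdiff \<Gamma> i x =
     subdifferential (section_cost \<Gamma> i x) (own \<Gamma> i x) \<inter> pspace \<Gamma> i"

definition pseudo_subdiff :: "('p::finite, 'c::finite, 'm::finite) game \<Rightarrow> real^'c \<Rightarrow> (real^'c) set" where
  "pseudo_subdiff \<Gamma> x = {g. \<forall>i. own \<Gamma> i g \<in> partial_subdiff \<Gamma> i x}"

definition GNE :: "('p::finite, 'c::finite, 'm::finite) game \<Rightarrow> real^'c \<Rightarrow> bool" where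
  "GNE \<Gamma> x \<longleftrightarrow>
     (\<forall>i. is_arg_min (\<lambda>y. cost \<Gamma> i (deviate \<Gamma> i y x)) (\<lambda>y. y \<in> feasible \<Gamma> i x) (own \<Gamma> i x))"

definition GVI_solution :: "('p::finite, 'c::finite, 'm::finite) game \<Rightarrow> real^'c \<Rightarrow> bool" where
  "GVI_solution \<Gamma> x \<longleftrightarrow> x \<in> shared_set \<Gamma> \<and>
     (\<exists>l\<in>pseudo_subdiff \<Gamma> x. \<forall>y\<in>shared_set \<Gamma>. 0 \<le> l \<bullet> (y - x))"

definition variational_GNE :: "('p::finite, 'c::finite, 'm::finite) game \<Rightarrow> real^'c \<Rightarrow> bool" where
  "variational_GNE \<Gamma> x \<longleftrightarrow> GNE \<Gamma> x \<and> GVI_solution \<Gamma> x"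

text \<open>
  Interiors of sets of decisions of one player are taken relative to \<open>pspace \<Gamma> i\<close>.
\<close>

definition regular_game :: "('p::finite, 'c::finite, 'm::finite) game \<Rightarrow> bool" where
  "regular_game \<Gamma> \<longleftrightarrow>
     (\<forall>i x. (\<forall>j. j \<noteq> i \<longrightarrow> own \<Gamma> j x \<in> strat \<Gamma> j) \<longrightarrow>
        proper_function (section_cost \<Gamma> i x) \<and> lsc_function (section_cost \<Gamma> i x) \<and>
        convex_function (section_cost \<Gamma> i x)) \<and>
     maximally_monotone (pseudo_subdiff \<Gamma>) \<and>
     (\<forall>i. strat \<Gamma> i \<subseteq> pspace \<Gamma> i \<and> closed (strat \<Gamma> i) \<and> convex (strat \<Gamma> i) \<and>
        top_of_set (pspace \<Gamma> i) interior_of strat \<Gamma> i \<noteq> {}) \<and>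
     interior (shared_set \<Gamma>) \<noteq> {} \<and>
     (\<forall>i x. (\<forall>j. j \<noteq> i \<longrightarrow> own \<Gamma> j x \<in> strat \<Gamma> j) \<longrightarrow>
        top_of_set (pspace \<Gamma> i) interior_of feasible \<Gamma> i x \<noteq> {})"


section \<open>The communication graph\<close>

text \<open>
  An undirected graph with oriented edges is a digraph with at most one arc
  between any two vertices.  The type \<open>'e\<close> only provides names for the edges, the
  edges being \<open>arcs G\<close>; a stacked edge variable is zero at unused names.
\<close>

definition oriented_graph :: "('p, 'e) pre_digraph \<Rightarrow> bool" where
  "oriented_graph G \<longleftrightarrow> verts G = UNIV \<and> loopfree_digraph G \<and>
     inj_on (\<lambda>l. {tail G l, head G l}) (arcs G)"

definition edge_col :: "('p, 'e::finite) pre_digraph \<Rightarrow> ('e \<Rightarrow> real^'m) \<Rightarrow> real^('e \<times> 'm)" where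
  "edge_col G z = col (\<lambda>l. if l \<in> arcs G then z l else 0)"

definition incidence :: "('p::finite, 'e::finite) pre_digraph \<Rightarrow> real^'e^'p" where
  "incidence G = (\<chi> i l. if l \<in> in_arcs G i then 1 else if l \<in> out_arcs G i then - 1 else 0)"

definition Vbar :: "('p::finite, 'e::finite) pre_digraph \<Rightarrow> real^('e \<times> 'm::finite)^('p \<times> 'm)" where
  "Vbar G = kron (incidence G) (mat 1)"


section \<open>The operator, the preconditioning matrix and the algorithm\<close>

definition Lambda :: "('p::finite, 'c::finite, 'm::finite) game \<Rightarrow> real^'c^('p \<times> 'm)" where
  "Lambda \<Gamma> = (\<chi> q c. if owner \<Gamma> c = fst q then cmat \<Gamma> (fst q) $ snd q $ c else 0)"

definition KKT_operator ::
  "('p::finite, 'c::finite, 'm::finite) game \<Rightarrow> ('p, 'e::finite) pre_digraph \<Rightarrow>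
   (real^'c) \<times> (real^('e \<times> 'm)) \<times> (real^('p \<times> 'm)) \<Rightarrow>
   ((real^'c) \<times> (real^('e \<times> 'm)) \<times> (real^('p \<times> 'm))) set" where
  "KKT_operator \<Gamma> G = (\<lambda>(x, Z, L).
     {(transpose (Lambda \<Gamma>) *v L + (u + g),
       transpose (Vbar G) *v L,
       - (Lambda \<Gamma> *v x) - Vbar G *v Z + col (cvec \<Gamma>) + w) | u g w.
       u \<in> normal_cone (profiles \<Gamma>) x \<and> g \<in> pseudo_subdiff \<Gamma> x \<and> w \<in> normal_cone orthant L})"

definition Rdiag :: "('p::finite, 'c::finite, 'm::finite) game \<Rightarrow> ('p \<Rightarrow> real^'c^'c) \<Rightarrow> real^'c^'c" where
  "Rdiag \<Gamma> R = (\<chi> c d. if owner \<Gamma> c = owner \<Gamma> d then R (owner \<Gamma> c) $ c $ d else 0)"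

definition block3 ::
  "real^'a^'a \<Rightarrow> real^'b^'a \<Rightarrow> real^'c^'a \<Rightarrow>
   real^'a^'b \<Rightarrow> real^'b^'b \<Rightarrow> real^'c^'b \<Rightarrow>
   real^'a^'c \<Rightarrow> real^'b^'c \<Rightarrow> real^'c^'c \<Rightarrow> real^('a + 'b + 'c)^('a + 'b + 'c)" where
  "block3 P11 P12 P13 P21 P22 P23 P31 P32 P33 = (\<chi> p q.
     case p of
       Inl i \<Rightarrow> (case q of Inl j \<Rightarrow> P11 $ i $ j | Inr (Inl j) \<Rightarrow> P12 $ i $ j | Inr (Inr j) \<Rightarrow> P13 $ i $ j)
     | Inr (Inl i) \<Rightarrow> (case q of Inl j \<Rightarrow> P21 $ i $ j | Inr (Inl j) \<Rightarrow> P22 $ i $ j | Inr (Inr j) \<Rightarrow> P23 $ i $ j)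
     | Inr (Inr i) \<Rightarrow> (case q of Inl j \<Rightarrow> P31 $ i $ j | Inr (Inl j) \<Rightarrow> P32 $ i $ j | Inr (Inr j) \<Rightarrow> P33 $ i $ j))"

text \<open>The inverses of the block diagonal matrices \<open>W\<close> and \<open>H\<close> are taken block by block.\<close>

definition Phi ::
  "('p::finite, 'c::finite, 'm::finite) game \<Rightarrow> ('p, 'e::finite) pre_digraph \<Rightarrow>
   ('p \<Rightarrow> real^'c^'c) \<Rightarrow> ('p \<Rightarrow> real^'m^'m) \<Rightarrow> ('e \<Rightarrow> real^'m^'m) \<Rightarrow>
   real^('c + 'e \<times> 'm + 'p \<times> 'm)^('c + 'e \<times> 'm + 'p \<times> 'm)" where
  "Phi \<Gamma> G R H W = block3
     (Rdiag \<Gamma> R)    0                               (- transpose (Lambda \<Gamma>))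
     0              (blkdiag (\<lambda>l. matrix_inv (W l)))  (- transpose (Vbar G))
     (- Lambda \<Gamma>)   (- Vbar G)                      (blkdiag (\<lambda>i. matrix_inv (H i)))"

text \<open>The coordinates of \<open>Phi\<close> that belong to unused edge names are discarded.\<close>

definition Phi_space :: "('p::finite, 'e::finite) pre_digraph \<Rightarrow> (real^('c::finite + 'e \<times> 'm::finite + 'p \<times> 'm)) set" where
  "Phi_space G = {v. \<forall>l r. l \<notin> arcs G \<longrightarrow> v $ Inr (Inl (l, r)) = 0}"

definition admissible_parameters ::
  "('p::finite, 'c::finite, 'm::finite) game \<Rightarrow> ('p, 'e::finite) pre_digraph \<Rightarrow>
   ('p \<Rightarrow> real^'c^'c) \<Rightarrow> ('p \<Rightarrow> real^'m^'m) \<Rightarrow> ('e \<Rightarrow> real^'m^'m) \<Rightarrow> bool" where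
  "admissible_parameters \<Gamma> G R H W \<longleftrightarrow>
     (\<forall>i. posdef_on (pspace \<Gamma> i) (R i)) \<and> (\<forall>i. posdef_on UNIV (H i)) \<and>
     (\<forall>l\<in>arcs G. posdef_on UNIV (W l)) \<and>
     posdef_on (Phi_space G) (Phi \<Gamma> G R H W)"

definition subgame_cost ::
  "('p::finite, 'c::finite, 'm::finite) game \<Rightarrow> ('p \<Rightarrow> real^'c^'c) \<Rightarrow> real^'c \<Rightarrow> ('p \<Rightarrow> real^'m) \<Rightarrow>
   'p \<Rightarrow> real^'c \<Rightarrow> real" where
  "subgame_cost \<Gamma> R xk lamk i x =
     cost \<Gamma> i x + 1/2 * sqnorm (R i) (own \<Gamma> i x - own \<Gamma> i xk) + lamk i \<bullet> (cmat \<Gamma> i *v own \<Gamma> i x)"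

definition subgame_NE ::
  "('p::finite, 'c::finite, 'm::finite) game \<Rightarrow> ('p \<Rightarrow> real^'c^'c) \<Rightarrow> real^'c \<Rightarrow> ('p \<Rightarrow> real^'m) \<Rightarrow>
   real^'c \<Rightarrow> bool" where
  "subgame_NE \<Gamma> R xk lamk x \<longleftrightarrow>
     (\<forall>i. is_arg_min (\<lambda>y. subgame_cost \<Gamma> R xk lamk i (deviate \<Gamma> i y x))
            (\<lambda>y. y \<in> strat \<Gamma> i) (own \<Gamma> i x))"

text \<open>One iteration, with error bound \<open>\<mu>\<close>, from \<open>(x, z, lam)\<close> to \<open>(x', z', lam')\<close>.\<close>

definition algorithm_step ::
  "('p::finite, 'c::finite, 'm::finite) game \<Rightarrow> ('p, 'e::finite) pre_digraph \<Rightarrow>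
   ('p \<Rightarrow> real^'c^'c) \<Rightarrow> ('p \<Rightarrow> real^'m^'m) \<Rightarrow> ('e \<Rightarrow> real^'m^'m) \<Rightarrow> real \<Rightarrow> real \<Rightarrow>
   real^'c \<Rightarrow> ('e \<Rightarrow> real^'m) \<Rightarrow> ('p \<Rightarrow> real^'m) \<Rightarrow>
   real^'c \<Rightarrow> ('e \<Rightarrow> real^'m) \<Rightarrow> ('p \<Rightarrow> real^'m) \<Rightarrow> bool" where
  "algorithm_step \<Gamma> G R H W \<rho> \<mu> x z lam x' z' lam' \<longleftrightarrow>
     (\<exists>xhat xt zt lamt.
        subgame_NE \<Gamma> R x lam xhat \<and> norm (xt - xhat) \<le> \<mu> \<and>
        x' = x + \<rho> *\<^sub>R (xt - x) \<and>
        (\<forall>l\<in>arcs G. zt l = z l - W l *v (lam (head G l) - lam (tail G l)) \<and>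
                    z' l = z l + \<rho> *\<^sub>R (zt l - z l)) \<and>
        (\<forall>i. lamt i = projection (matrix_inv (H i)) orthant
               (lam i + H i *v (cmat \<Gamma> i *v own \<Gamma> i (2 *\<^sub>R xt - x)
                  + (\<Sum>l\<in>in_arcs G i \<union> out_arcs G i. incidence G $ i $ l *\<^sub>R (2 *\<^sub>R zt l - z l))
                  - cvec \<Gamma> i)) \<and>
             lam' i = lam i + \<rho> *\<^sub>R (lamt i - lam i)))"

end

theory Submission
  imports Defs
begin

text \<open>The algorithm is a proximal point iteration in disguise.  Write \<open>w = (x, Z, L)\<close> for the
  iterate and \<open>\<Psi>\<close> for the action of \<open>Phi\<close> on such triples.  If the players' step is carried out
  exactly, the new point \<open>v\<close> before relaxation satisfies \<open>\<Psi> (w - v) \<in> T v\<close>, where \<open>T\<close> is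
  \<open>KKT_operator\<close>: the off-diagonal blocks of \<open>Phi\<close> are chosen so that the three inclusions
  decouple.  The subgame equilibrium condition is the first one, the explicit edge update the second
  one, and the projection formula for the multipliers (with its extrapolated arguments
  \<open>2 x' - x\<close> and \<open>2 Z' - Z\<close>) the third one (\<open>algorithm_step_resolvent\<close>).  An error of size \<open>\<mu>\<close> in
  the subgame perturbs the result by at most a constant times \<open>\<mu>\<close>, since projections are Lipschitz.

  For such an iteration, the distances to any zero of the monotone operator \<open>T\<close>, measured in the norm
  of \<open>Phi\<close>, are decreasing up to a summable error, and the residuals \<open>v - w\<close> tend to zero.
  The iterates are therefore bounded, a cluster point is a zero of \<open>T\<close> because the graph of \<open>T\<close> is
  closed, and convergence of the distances to this particular zero turns the cluster point into a limit
  (\<open>relaxed_proximal_point_convergence\<close>).  Adding a normal vector of the strategy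
  sets to a pseudo-subgradient gives a pseudo-subgradient again (\<open>normal_cone_absorbed\<close>), so \<open>T\<close> inherits
  the closed graph from the maximally monotone pseudo-subdifferential (\<open>KKT_operator_closed\<close>).

  The argument starts from one zero of \<open>T\<close>.  Given a solution of the variational
  inequality, a separating hyperplane produces a multiplier for the shared constraint
  (\<open>multipliers_of_solid_constraint_set\<close>); all players use this multiplier, and the
  constraint residual is split evenly among them.  What remains to be balanced sums to zero over
  the players, hence is the divergence of some edge variable because the graph is connected
  (\<open>range_Vbar\<close>).  Conversely, at a zero of \<open>T\<close> the second block forces consensus of the multipliers,
  and summing the third block over the players recovers the shared constraint with complementary
  slackness (\<open>zer_KKT_imp_GVI_solution\<close>).\<close>

section \<open>Positive definite forms on a subspace\<close>

text \<open>Positivity is required on a subspace only, because the coordinates of other players and of unused edge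
  names carry no information about the matrices.  The operator may map the subspace outside itself.\<close>

locale posdef_form =
  fixes S :: "'a::euclidean_space set" and B :: "'a \<Rightarrow> 'a"
  assumes subspace: "subspace S" and linear: "linear B"
    and symmetric: "\<lbrakk>u \<in> S; v \<in> S\<rbrakk> \<Longrightarrow> u \<bullet> B v = B u \<bullet> v"
    and positive: "\<lbrakk>v \<in> S; v \<noteq> 0\<rbrakk> \<Longrightarrow> 0 < v \<bullet> B v"
begin

definition energy :: "'a \<Rightarrow> real" where "energy v = sqrt (v \<bullet> B v)"

lemma nonneg: "v \<in> S \<Longrightarrow> 0 \<le> v \<bullet> B v"
  using positive[of v] by (cases "v = 0") auto

lemma energy_square: "v \<in> S \<Longrightarrow> (energy v)\<^sup>2 = v \<bullet> B v"
  by (simp add: energy_def nonneg)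

lemma energy_nonneg: "v \<in> S \<Longrightarrow> 0 \<le> energy v"
  by (simp add: energy_def nonneg)

lemma quadratic_expansion:
  assumes "u \<in> S" "v \<in> S"
  shows "(u + t *\<^sub>R v) \<bullet> B (u + t *\<^sub>R v) = u \<bullet> B u + 2 * t * (v \<bullet> B u) + t\<^sup>2 * (v \<bullet> B v)"
  using symmetric[OF assms]
  by (simp add: linear_add[OF linear] linear_cmul[OF linear] inner_add_left inner_add_right
      inner_commute power2_eq_square algebra_simps)

text \<open>The minimum over \<open>t\<close> of the nonnegative quadratic \<open>(u + t v) \<bullet> B (u + t v)\<close> is attained at the value of
  \<open>t\<close> used below.\<close>

lemma cauchy_schwarz:
  assumes "u \<in> S" "v \<in> S"
  shows "v \<bullet> B u \<le> energy u * energy v"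
proof (cases "v = 0")
  case False
  then have p: "0 < v \<bullet> B v" using positive assms by auto
  let ?t = "- (v \<bullet> B u) / (v \<bullet> B v)"
  have "0 \<le> (u + ?t *\<^sub>R v) \<bullet> B (u + ?t *\<^sub>R v)"
    by (intro nonneg subspace_add subspace_scale subspace assms)
  also have "\<dots> = u \<bullet> B u - (v \<bullet> B u)\<^sup>2 / (v \<bullet> B v)"
    unfolding quadratic_expansion[OF assms] using p by (simp add: power2_eq_square field_simps)
  finally have "(v \<bullet> B u)\<^sup>2 \<le> (u \<bullet> B u) * (v \<bullet> B v)"
    using p by (simp add: field_simps)
  then show ?thesis
    unfolding energy_def real_sqrt_mult[symmetric] by (rule real_le_rsqrt)
qed (simp add: energy_def linear_0[OF linear])

lemma energy_triangle:
  assumes "u \<in> S" "v \<in> S"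
  shows "energy (u + v) \<le> energy u + energy v"
proof (rule power2_le_imp_le)
  have "(energy (u + v))\<^sup>2 = u \<bullet> B u + 2 * (v \<bullet> B u) + v \<bullet> B v"
    using quadratic_expansion[OF assms, of 1] energy_square[of "u + v"] subspace_add[OF subspace assms]
    by simp
  also have "\<dots> \<le> (energy u + energy v)\<^sup>2"
    using cauchy_schwarz[OF assms] energy_square assms by (simp add: power2_sum)
  finally show "(energy (u + v))\<^sup>2 \<le> (energy u + energy v)\<^sup>2" .
qed (simp add: energy_nonneg assms)

text \<open>Compactness of the unit sphere of the subspace makes the energy norm equivalent to the Euclidean one;
  this bound gives boundedness of iterates, the next one transports error estimates.\<close>

lemma norm_le_energy:
  obtains c where "0 < c" "\<And>v. v \<in> S \<Longrightarrow> c * norm v \<le> energy v"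
proof -
  let ?K = "S \<inter> sphere 0 1"
  have cont: "continuous_on ?K (\<lambda>v. v \<bullet> B v)"
    by (intro continuous_intros linear_continuous_on linear_conv_bounded_linear[THEN iffD1, OF linear])
  have comp: "compact ?K"
    by (intro closed_Int_compact closed_subspace subspace compact_sphere)
  obtain m where m: "0 < m" "\<And>v. v \<in> ?K \<Longrightarrow> m \<le> v \<bullet> B v"
  proof (cases "?K = {}")
    case True
    then show ?thesis using that[of 1] by auto
  next
    case False
    from continuous_attains_inf[OF comp False cont] obtain v0 where
      "v0 \<in> ?K" "\<forall>v\<in>?K. v0 \<bullet> B v0 \<le> v \<bullet> B v" by auto
    then show ?thesis using that[of "v0 \<bullet> B v0"] positive[of v0] by fastforce
  qed
  have "sqrt m * norm v \<le> energy v" if v: "v \<in> S" for v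
  proof (cases "v = 0")
    case False
    let ?u = "(1 / norm v) *\<^sub>R v"
    have "m \<le> ?u \<bullet> B ?u"
      using False v by (intro m) (simp add: subspace_scale[OF subspace])
    then have "m * (norm v)\<^sup>2 \<le> v \<bullet> B v"
      using False by (simp add: linear_cmul[OF linear] field_simps power2_eq_square)
    then have "sqrt (m * (norm v)\<^sup>2) \<le> energy v" by (simp add: energy_def)
    then show ?thesis by (simp add: real_sqrt_mult)
  qed (simp add: energy_def linear_0[OF linear])
  then show thesis using that[of "sqrt m"] m by simp
qed

lemma energy_le_norm:
  obtains C where "0 < C" "\<And>v. v \<in> S \<Longrightarrow> energy v \<le> C * norm v"
proof -
  obtain K where K: "0 < K" "\<And>v. norm (B v) \<le> K * norm v"
    using linear_bounded_pos[OF linear] by auto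
  have "energy v \<le> sqrt K * norm v" if "v \<in> S" for v
  proof -
    have "v \<bullet> B v \<le> norm v * norm (B v)" by (rule norm_cauchy_schwarz)
    also have "\<dots> \<le> norm v * (K * norm v)" by (intro mult_left_mono K norm_ge_zero)
    finally have "v \<bullet> B v \<le> K * (norm v)\<^sup>2" by (simp add: power2_eq_square ac_simps)
    then have "energy v \<le> sqrt (K * (norm v)\<^sup>2)" by (simp add: energy_def)
    then show ?thesis by (simp add: real_sqrt_mult)
  qed
  then show thesis using that[of "sqrt K"] K by simp
qed

end

section \<open>Relaxed proximal point iterations with summable errors\<close>

text \<open>Subtracting the partial sums of the errors leaves a decreasing sequence that is bounded below.\<close>

lemma quasi_decreasing_convergent:
  fixes a \<epsilon> :: "nat \<Rightarrow> real"
  assumes a: "\<And>k. 0 \<le> a k" and step: "\<And>k. a (Suc k) \<le> a k + \<epsilon> k"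
    and eps: "\<And>k. 0 \<le> \<epsilon> k" "summable \<epsilon>"
  obtains l where "a \<longlonglongrightarrow> l"
proof -
  let ?s = "\<lambda>k. sum \<epsilon> {..<k}"
  have "decseq (\<lambda>k. a k - ?s k)"
    unfolding decseq_Suc_iff using step by (simp add: algebra_simps)
  moreover have "- suminf \<epsilon> \<le> a k - ?s k" for k
    using a[of k] sum_le_suminf[OF eps(2), of "{..<k}"] eps(1) by fastforce
  ultimately obtain l where "(\<lambda>k. a k - ?s k) \<longlonglongrightarrow> l"
    using decseq_convergent by blast
  from tendsto_add[OF this summable_LIMSEQ[OF eps(2)]] show thesis using that by simp
qed

context posdef_form
begin

text \<open>For a zero \<open>s\<close> of a monotone operator and a resolvent point \<open>v\<close> of \<open>w\<close>, the hypothesis \<open>mono\<close> is monotonicity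
  between \<open>v\<close> and \<open>s\<close>; it says that, in the geometry of \<open>B\<close>, the directions from \<open>v\<close> to \<open>w\<close> and
  to \<open>s\<close> enclose at least a right angle.  This leaves room for over-relaxation by factors up to \<open>2\<close>.\<close>

lemma relaxed_step_decrease:
  assumes S: "w \<in> S" "v \<in> S" "s \<in> S" and mono: "0 \<le> B (w - v) \<bullet> (v - s)" and "0 \<le> \<rho>"
  shows "(energy (w + \<rho> *\<^sub>R (v - w) - s))\<^sup>2
    \<le> (energy (w - s))\<^sup>2 - \<rho> * (2 - \<rho>) * (energy (v - w))\<^sup>2"
proof -
  have d: "w - s \<in> S" "v - w \<in> S" "v - s \<in> S" using S subspace_diff[OF subspace] by auto
  have sum: "w - s + \<rho> *\<^sub>R (v - w) \<in> S" 
    by (intro subspace_add subspace_scale subspace d)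
  have "w + \<rho> *\<^sub>R (v - w) - s = w - s + \<rho> *\<^sub>R (v - w)" by simp
  then have "(energy (w + \<rho> *\<^sub>R (v - w) - s))\<^sup>2 =
      (energy (w - s))\<^sup>2 + 2 * \<rho> * ((v - w) \<bullet> B (w - s)) + \<rho>\<^sup>2 * (energy (v - w))\<^sup>2"
    using quadratic_expansion[OF d(1,2), of \<rho>] sum d by (simp only: energy_square)
  moreover have "(v - w) \<bullet> B (w - s) = - (B (w - v) \<bullet> (v - s)) - (energy (v - w))\<^sup>2"
  proof -
    have "(v - w) \<bullet> B (w - s) = (v - w) \<bullet> B (v - s) - (v - w) \<bullet> B (v - w)"
      by (simp add: inner_diff_right[symmetric] linear_diff[OF linear, symmetric])
    moreover have "B (v - w) = - B (w - v)"
      using linear_neg[OF linear, of "w - v"] by simp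
    ultimately show ?thesis
      unfolding energy_square[OF d(2)] symmetric[OF d(2,3)] by simp
  qed
  moreover have "0 \<le> 2 * \<rho> * (B (w - v) \<bullet> (v - s))" using assms by simp
  ultimately show ?thesis by (simp only: right_diff_distrib left_diff_distrib power2_eq_square)
qed

text \<open>The distances \<open>a\<close> of the iterates to \<open>s\<close> and the distances \<open>b\<close> of the exactly relaxed points
  interlace, \<open>b k \<le> a k\<close> and \<open>a (k + 1) \<le> b k + C \<epsilon> k\<close>.  They thus share a limit, and the
  decrease \<open>a\<^sup>2 - b\<^sup>2\<close>, which dominates \<open>\<rho> (2 - \<rho>)\<close> times the
  squared residual, vanishes.\<close>

lemma quasi_fejer:
  assumes mono: "monotone_operator T" and s: "s \<in> zer T" "s \<in> S"
    and S: "\<And>k. w k \<in> S" "\<And>k. v k \<in> S"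
    and res: "\<And>k. B (w k - v k) \<in> T (v k)"
    and err: "\<And>k. norm (w (Suc k) - (w k + \<rho> *\<^sub>R (v k - w k))) \<le> \<epsilon> k" "summable \<epsilon>"
    and rho: "0 < \<rho>" "\<rho> < 2"
  obtains l where "(\<lambda>k. energy (w k - s)) \<longlonglongrightarrow> l" and "(\<lambda>k. energy (v k - w k)) \<longlonglongrightarrow> 0"
proof -
  let ?a = "\<lambda>k. energy (w k - s)" and ?d = "\<lambda>k. energy (v k - w k)"
  let ?b = "\<lambda>k. energy (w k + \<rho> *\<^sub>R (v k - w k) - s)"
  obtain C where C: "0 < C" "\<And>v. v \<in> S \<Longrightarrow> energy v \<le> C * norm v"
    using energy_le_norm by blast
  have in_S: "w k + \<rho> *\<^sub>R (v k - w k) \<in> S" "w k - s \<in> S" "v k - w k \<in> S" for k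
    using S s by (auto intro!: subspace_add subspace_diff subspace_scale subspace)
  have bS: "w k + \<rho> *\<^sub>R (v k - w k) - s \<in> S" for k
    by (intro subspace_diff subspace in_S s)
  have "0 \<le> B (w k - v k) \<bullet> (v k - s)" for k
    using mono res[of k] s unfolding monotone_operator_def zer_def by fastforce
  then have sq: "(?b k)\<^sup>2 \<le> (?a k)\<^sup>2 - \<rho> * (2 - \<rho>) * (?d k)\<^sup>2" for k
    using relaxed_step_decrease[OF S(1)[of k] S(2)[of k] s(2)] rho by simp
  have ba: "?b k \<le> ?a k" for k
  proof (rule power2_le_imp_le)
    have "0 \<le> \<rho> * (2 - \<rho>) * (?d k)\<^sup>2" using rho by simp
    then show "(?b k)\<^sup>2 \<le> (?a k)\<^sup>2" using sq[of k] by linarith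
  qed (simp add: energy_nonneg in_S)
  have ab: "?a (Suc k) \<le> ?b k + C * \<epsilon> k" for k
  proof -
    let ?e = "w (Suc k) - (w k + \<rho> *\<^sub>R (v k - w k))"
    have e: "?e \<in> S" by (intro subspace_diff subspace in_S S)
    have "?a (Suc k) = energy ((w k + \<rho> *\<^sub>R (v k - w k) - s) + ?e)" by (simp add: algebra_simps)
    also have "\<dots> \<le> ?b k + energy ?e" by (rule energy_triangle[OF bS e])
    also have "energy ?e \<le> C * \<epsilon> k"
      using C(2)[OF e] err(1)[of k] C(1) by (meson mult_le_cancel_left_pos order_trans)
    finally show ?thesis by simp
  qed
  have ce: "summable (\<lambda>k. C * \<epsilon> k)" using err(2) by (rule summable_mult)
  have eps: "0 \<le> C * \<epsilon> k" for k
    using C(1) order_trans[OF norm_ge_zero err(1)] by simp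
  have "?a (Suc k) \<le> ?a k + C * \<epsilon> k" for k using ab[of k] ba[of k] by linarith
  then obtain l where l: "?a \<longlonglongrightarrow> l"
    by (rule quasi_decreasing_convergent[of ?a "\<lambda>k. C * \<epsilon> k", OF energy_nonneg[OF in_S(2)] _ eps ce])
  have "(\<lambda>k. ?a (Suc k) - C * \<epsilon> k) \<longlonglongrightarrow> l - 0"
    by (intro tendsto_diff LIMSEQ_Suc l summable_LIMSEQ_zero ce)
  then have "(\<lambda>k. ?a (Suc k) - C * \<epsilon> k) \<longlonglongrightarrow> l" by simp
  from tendsto_sandwich[OF _ _ this l, of ?b] have b: "?b \<longlonglongrightarrow> l"
    using ab ba by (simp add: algebra_simps)
  have gap: "(\<lambda>k. ((?a k)\<^sup>2 - (?b k)\<^sup>2) / (\<rho> * (2 - \<rho>))) \<longlonglongrightarrow> (l\<^sup>2 - l\<^sup>2) / (\<rho> * (2 - \<rho>))"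
    using rho by (intro tendsto_intros l b) simp
  have "(\<lambda>k. (?d k)\<^sup>2) \<longlonglongrightarrow> 0"
  proof (rule tendsto_sandwich[OF _ _ tendsto_const gap[unfolded diff_self div_0]])
    have "(?d k)\<^sup>2 \<le> ((?a k)\<^sup>2 - (?b k)\<^sup>2) / (\<rho> * (2 - \<rho>))" for k
      using sq[of k] rho by (simp add: field_simps)
    then show "\<forall>\<^sub>F k in sequentially. (?d k)\<^sup>2 \<le> ((?a k)\<^sup>2 - (?b k)\<^sup>2) / (\<rho> * (2 - \<rho>))" by simp
  qed simp
  then have "?d \<longlonglongrightarrow> 0"
    using tendsto_real_sqrt[of "\<lambda>k. (?d k)\<^sup>2" 0 sequentially] by (simp add: energy_nonneg in_S)
  with l show thesis by (rule that)
qed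

lemma energy_LIMSEQ_0_iff:
  assumes "\<And>k. u k \<in> S"
  shows "(\<lambda>k. energy (u k)) \<longlonglongrightarrow> 0 \<longleftrightarrow> u \<longlonglongrightarrow> 0"
proof
  obtain c where c: "0 < c" "\<And>v. v \<in> S \<Longrightarrow> c * norm v \<le> energy v"
    using norm_le_energy by blast
  assume "(\<lambda>k. energy (u k)) \<longlonglongrightarrow> 0"
  then have l: "(\<lambda>k. energy (u k) / c) \<longlonglongrightarrow> 0" using tendsto_divide_zero by blast
  have "norm (u k) \<le> energy (u k) / c" for k using c(2)[OF assms[of k]] c(1) by (simp add: field_simps)
  then show "u \<longlonglongrightarrow> 0" by (intro Lim_null_comparison[OF _ l] always_eventually) simp
next
  obtain C where C: "0 < C" "\<And>v. v \<in> S \<Longrightarrow> energy v \<le> C * norm v"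
    using energy_le_norm by blast
  assume "u \<longlonglongrightarrow> 0"
  then have l: "(\<lambda>k. C * norm (u k)) \<longlonglongrightarrow> 0" using tendsto_mult_right_zero tendsto_norm_zero by blast
  show "(\<lambda>k. energy (u k)) \<longlonglongrightarrow> 0"
    using C(2)[OF assms] energy_nonneg[OF assms]
    by (intro Lim_null_comparison[OF _ l] always_eventually) (simp add: assms)
qed

text \<open>Opial's argument: along a convergent subsequence the resolvent points converge to the same limit \<open>p\<close> as
  the iterates, so \<open>p\<close> is a zero; the distances to \<open>p\<close> converge and have a null subsequence.\<close>

theorem relaxed_proximal_point_convergence:
  assumes mono: "monotone_operator T" and s: "s \<in> zer T" "s \<in> S"
    and closed: "\<And>v u p. \<lbrakk>\<And>k. u k \<in> T (v k); v \<longlonglongrightarrow> p; u \<longlonglongrightarrow> 0\<rbrakk> \<Longrightarrow> p \<in> zer T"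
    and S: "\<And>k. w k \<in> S" "\<And>k. v k \<in> S"
    and res: "\<And>k. B (w k - v k) \<in> T (v k)"
    and err: "\<And>k. norm (w (Suc k) - (w k + \<rho> *\<^sub>R (v k - w k))) \<le> \<epsilon> k" "summable \<epsilon>"
    and rho: "0 < \<rho>" "\<rho> < 2"
  shows "\<exists>p \<in> zer T. w \<longlonglongrightarrow> p"
proof -
  note fejer = quasi_fejer[OF mono _ _ S res err rho]
  obtain l where l: "(\<lambda>k. energy (w k - s)) \<longlonglongrightarrow> l" and "(\<lambda>k. energy (v k - w k)) \<longlonglongrightarrow> 0"
    by (rule fejer[OF s])
  then have gap: "(\<lambda>k. v k - w k) \<longlonglongrightarrow> 0"
    by (subst (asm) energy_LIMSEQ_0_iff) (intro subspace_diff subspace S)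
  obtain c where c: "0 < c" "\<And>v. v \<in> S \<Longrightarrow> c * norm v \<le> energy v"
    using norm_le_energy by blast
  from l obtain D where D: "\<And>k. energy (w k - s) \<le> D"
    using convergent_imp_Bseq[OF convergentI[OF l]] unfolding Bseq_def real_norm_def
    by (meson abs_le_D1)
  have "norm (w k - s) \<le> D / c" for k
    using c(2)[OF subspace_diff[OF subspace S(1) s(2)], of k] D[of k] c(1) by (simp add: field_simps)
  then have "range w \<subseteq> cball s (D / c)" by (auto simp: dist_norm norm_minus_commute)
  then have "bounded (range w)" using bounded_subset bounded_cball by blast
  then obtain p r where r: "strict_mono (r :: nat \<Rightarrow> nat)" and p: "(w \<circ> r) \<longlonglongrightarrow> p"
    using bounded_imp_convergent_subsequence by blast
  have pS: "p \<in> S"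
    using closed_sequentially[OF closed_subspace[OF subspace] _ p] S by auto
  (* The residuals tend to zero, so the resolvent points follow the iterates along the subsequence. *)
  have gap_r: "(\<lambda>k. v (r k) - w (r k)) \<longlonglongrightarrow> 0"
    using LIMSEQ_subseq_LIMSEQ[OF gap r] by (simp add: o_def)
  have "(\<lambda>k. w (r k) + (v (r k) - w (r k))) \<longlonglongrightarrow> p + 0"
    using p by (intro tendsto_add gap_r) (simp add: o_def)
  then have vr: "(\<lambda>k. v (r k)) \<longlonglongrightarrow> p" by simp
  have "(\<lambda>k. w (r k) - v (r k)) \<longlonglongrightarrow> 0" using tendsto_minus[OF gap_r] by simp
  then have "(\<lambda>k. B (w (r k) - v (r k))) \<longlonglongrightarrow> B 0"
    using linear_conv_bounded_linear[THEN iffD1, OF linear] bounded_linear.tendsto by blast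
  then have zero: "p \<in> zer T"
    unfolding linear_0[OF linear] by (rule closed[OF res vr])
  obtain l' where l': "(\<lambda>k. energy (w k - p)) \<longlonglongrightarrow> l'"
    by (rule fejer[OF zero pS])
  have diff: "w k - p \<in> S" for k by (intro subspace_diff subspace S pS)
  have "(\<lambda>k. w (r k) - p) \<longlonglongrightarrow> 0" using p by (simp add: LIM_zero_iff o_def)
  then have "(\<lambda>k. energy (w (r k) - p)) \<longlonglongrightarrow> 0"
    using energy_LIMSEQ_0_iff[of "\<lambda>k. w (r k) - p"] diff by simp
  then have "l' = 0"
    using LIMSEQ_unique[OF LIMSEQ_subseq_LIMSEQ[OF l' r]] by (simp add: o_def)
  then have "(\<lambda>k. w k - p) \<longlonglongrightarrow> 0"
    using l' energy_LIMSEQ_0_iff[of "\<lambda>k. w k - p"] diff by simp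
  then show ?thesis using zero by (auto simp: LIM_zero_iff)
qed

end

section \<open>Monotone operators, normal cones and projections\<close>

text \<open>A limit of pairs in the graph is in monotone relation with the whole graph, so adding it keeps the
  operator monotone; by maximality it is already there.\<close>

lemma maximally_monotone_closed_graph:
  fixes T :: "'a::real_inner \<Rightarrow> 'a set"
  assumes max: "maximally_monotone T"
    and u: "\<And>k. u k \<in> T (v k)" and lim: "v \<longlonglongrightarrow> p" "u \<longlonglongrightarrow> q"
  shows "q \<in> T p"
proof -
  have mono: "monotone_operator T" using max by (simp add: maximally_monotone_def)
  have limit: "0 \<le> (q - b) \<bullet> (p - a)" if "b \<in> T a" for a b
  proof (rule LIMSEQ_le_const)
    show "(\<lambda>k. (u k - b) \<bullet> (v k - a)) \<longlonglongrightarrow> (q - b) \<bullet> (p - a)"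
      by (intro tendsto_intros lim)
    show "\<exists>N. \<forall>k\<ge>N. 0 \<le> (u k - b) \<bullet> (v k - a)"
      using mono u that unfolding monotone_operator_def by blast
  qed
  have flip: "(q - b) \<bullet> (p - a) = (b - q) \<bullet> (a - p)" for a b
    by (simp add: algebra_simps)
  (* The graph extended by the limit pair. *)
  let ?S = "\<lambda>y. T y \<union> (if y = p then {q} else {})"
  have "monotone_operator ?S"
    unfolding monotone_operator_def
  proof (intro allI ballI)
    fix a b c d assume "c \<in> ?S a" "d \<in> ?S b"
    then consider "c \<in> T a" "d \<in> T b" | "c \<in> T a" "b = p" "d = q" | "a = p" "c = q" "d \<in> T b"
      | "a = b" by (auto split: if_splits)
    then show "0 \<le> (c - d) \<bullet> (a - b)"
    proof cases
      case 1
      then show ?thesis using mono unfolding monotone_operator_def by blast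
    next
      case 2
      then show ?thesis using limit[of c a] flip[of c a] by simp
    next
      case 3
      then show ?thesis using limit[of d b] by simp
    qed simp
  qed
  then have "?S = T"
    using max by (auto simp: maximally_monotone_def)
  from fun_cong[OF this, of p] show ?thesis by auto
qed

lemma normal_cone_monotone: "monotone_operator (normal_cone C)"
  unfolding monotone_operator_def
proof (intro allI ballI)
  fix x y u v assume "u \<in> normal_cone C x" "v \<in> normal_cone C y"
  then have "u \<bullet> (y - x) \<le> 0" "v \<bullet> (x - y) \<le> 0"
    by (auto simp: normal_cone_def split: if_splits)
  then show "0 \<le> (u - v) \<bullet> (x - y)" by (simp add: inner_diff_left inner_diff_right)
qed

lemma normal_cone_closed_graph:
  assumes "closed C" and u: "\<And>k. u k \<in> normal_cone C (v k)" and lim: "v \<longlonglongrightarrow> p" "u \<longlonglongrightarrow> q"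
  shows "q \<in> normal_cone C p"
proof -
  have v: "v k \<in> C" for k using u[of k] by (auto simp: normal_cone_def split: if_splits)
  then have "p \<in> C" using closed_sequentially[OF assms(1) _ lim(1)] by blast
  moreover have "q \<bullet> (y - p) \<le> 0" if "y \<in> C" for y
  proof (rule LIMSEQ_le_const2)
    show "(\<lambda>k. u k \<bullet> (y - v k)) \<longlonglongrightarrow> q \<bullet> (y - p)" by (intro tendsto_intros lim)
    show "\<exists>N. \<forall>k\<ge>N. u k \<bullet> (y - v k) \<le> 0"
      using u v that by (auto simp: normal_cone_def)
  qed
  ultimately show ?thesis by (simp add: normal_cone_def)
qed

lemma closed_orthant: "closed (orthant :: (real^'n) set)"
proof -
  have eq: "orthant = {v :: real^'n. \<forall>r. 0 \<le> v $ r}"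
    by (auto simp: orthant_def less_eq_vec_def)
  show ?thesis
    unfolding eq by (intro closed_Collect_all closed_Collect_le continuous_intros)
qed

lemma convex_orthant: "convex orthant"
  by (auto simp: convex_def orthant_def less_eq_vec_def)

lemma zero_in_orthant: "0 \<in> orthant"
  by (simp add: orthant_def)

text \<open>Complementary slackness: testing the cone condition at \<open>0\<close> and \<open>2 L\<close> gives orthogonality, at
  \<open>L\<close> plus a unit vector the sign condition.\<close>

lemma normal_cone_orthant_iff:
  "w \<in> normal_cone orthant L \<longleftrightarrow> 0 \<le> L \<and> w \<le> 0 \<and> w \<bullet> L = 0"
proof (intro iffI)
  assume w: "w \<in> normal_cone orthant L"
  then have L: "L \<in> orthant" and ineq: "\<And>y. y \<in> orthant \<Longrightarrow> w \<bullet> (y - L) \<le> 0"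
    by (auto simp: normal_cone_def split: if_splits)
  have "w $ r \<le> 0" for r
  proof -
    have "L + axis r 1 \<in> orthant" using L by (auto simp: orthant_def less_eq_vec_def axis_def)
    from ineq[OF this] show ?thesis by (simp add: inner_axis)
  qed
  moreover have "L + L \<in> orthant" using L by (auto simp: orthant_def less_eq_vec_def)
  from ineq[OF this] ineq[OF zero_in_orthant] have "w \<bullet> L = 0" by simp
  ultimately show "0 \<le> L \<and> w \<le> 0 \<and> w \<bullet> L = 0" using L by (simp add: orthant_def less_eq_vec_def)
next
  assume w: "0 \<le> L \<and> w \<le> 0 \<and> w \<bullet> L = 0"
  then have "w \<bullet> y \<le> 0" if "y \<in> orthant" for y
    using that unfolding inner_vec_def orthant_def
    by (intro sum_nonpos) (auto simp: less_eq_vec_def mult_nonpos_nonneg)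
  then show "w \<in> normal_cone orthant L"
    using w by (auto simp: normal_cone_def orthant_def inner_diff_right)
qed

lemma le_zero_if_le_scaled:
  fixes a b :: real
  assumes "\<And>t. \<lbrakk>0 < t; t \<le> 1\<rbrakk> \<Longrightarrow> a \<le> t * b"
  shows "a \<le> 0"
proof (rule tendsto_le[OF _ _ tendsto_const])
  show "((\<lambda>t. t * b) \<longlongrightarrow> 0) (at_right 0)" by (auto intro!: tendsto_eq_intros)
  show "\<forall>\<^sub>F t in at_right 0. a \<le> t * b"
    unfolding eventually_at_right_field using assms by (intro exI[of _ 1]) auto
qed simp

context posdef_form
begin

text \<open>Comparing the minimizer \<open>p\<close> with \<open>p + t (y - p)\<close> for small \<open>t\<close> shows that the negative gradient of the smooth
  part is a subgradient of \<open>f\<close> on \<open>C\<close>.  The function \<open>f\<close> is a player's cost in the subgames and is constant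
  for metric projections.\<close>

lemma minimizer_subgradient:
  assumes C: "convex C" "C \<subseteq> S" and a: "a \<in> S" and f: "convex_on C f" and p: "p \<in> C" and y: "y \<in> C"
    and min: "\<And>y. y \<in> C \<Longrightarrow> f p + 1/2 * ((p - a) \<bullet> B (p - a)) + l \<bullet> p
      \<le> f y + 1/2 * ((y - a) \<bullet> B (y - a)) + l \<bullet> y"
  shows "f p + - (B (p - a) + l) \<bullet> (y - p) \<le> f y"
proof -
  let ?d = "y - p"
  have d: "?d \<in> S" and pa: "p - a \<in> S" using C a p y by (auto intro: subspace_diff[OF subspace])
  have "- (B (p - a) + l) \<bullet> ?d - (f y - f p) \<le> t * (1/2 * (?d \<bullet> B ?d))" if t: "0 < t" "t \<le> 1" for t
  proof -
    let ?z = "p + t *\<^sub>R ?d"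
    have z: "?z = (1 - t) *\<^sub>R p + t *\<^sub>R y" by (simp add: algebra_simps)
    have "?z \<in> C" unfolding z using C(1) p y t by (simp add: convexD)
    from min[OF this] have "f p + 1/2 * ((p - a) \<bullet> B (p - a)) \<le> f ?z + 1/2 * ((p - a + t *\<^sub>R ?d) \<bullet> B (p - a + t *\<^sub>R ?d)) + t * (l \<bullet> ?d)"
      by (simp add: inner_add_right algebra_simps)
    also have "(p - a + t *\<^sub>R ?d) \<bullet> B (p - a + t *\<^sub>R ?d) 
      = (p - a) \<bullet> B (p - a) + 2 * t * (?d \<bullet> B (p - a)) + t\<^sup>2 * (?d \<bullet> B ?d)"
      by (rule quadratic_expansion[OF pa d])
    also have "f ?z \<le> (1 - t) * f p + t * f y"
      unfolding z using f p y t by (intro convex_onD) auto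
    finally have "0 \<le> t * ((f y - f p) + (B (p - a) + l) \<bullet> ?d + t * (1/2 * (?d \<bullet> B ?d)))"
      by (simp add: inner_add_left inner_commute[of "B (p - a)"] power2_eq_square distrib_left distrib_right left_diff_distrib right_diff_distrib)
    then have "0 \<le> (f y - f p) + (B (p - a) + l) \<bullet> ?d + t * (1/2 * (?d \<bullet> B ?d))"
      using t by (simp add: zero_le_mult_iff)
    then show ?thesis by (simp only: inner_minus_left)
  qed
  from le_zero_if_le_scaled[OF this] show ?thesis by simp
qed

text \<open>The quadratic form is coercive, so that minimization can be restricted to a compact part of \<open>C\<close>; its
  radius ensures that points outside are worse than \<open>y0\<close>.\<close>

lemma nearest_point_exists:
  assumes C: "closed C" "C \<noteq> {}" "C \<subseteq> S" and v: "v \<in> S"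
  obtains p where "p \<in> C" "\<And>y. y \<in> C \<Longrightarrow> (v - p) \<bullet> B (v - p) \<le> (v - y) \<bullet> B (v - y)"
proof -
  obtain c where c: "0 < c" "\<And>v. v \<in> S \<Longrightarrow> c * norm v \<le> energy v"
    using norm_le_energy by blast
  obtain y0 where y0: "y0 \<in> C" using C by blast
  have vC: "v - y \<in> S" if "y \<in> C" for y using that C v by (auto intro: subspace_diff[OF subspace])
  let ?K = "C \<inter> cball v (energy (v - y0) / c)"
  have y0K: "y0 \<in> ?K" using y0 c(1) c(2)[OF vC[OF y0]] by (simp add: dist_norm field_simps)
  have "compact ?K" using C(1) by (intro closed_Int_compact compact_cball)
  moreover have "continuous_on ?K (\<lambda>y. energy (v - y))"
    unfolding energy_def
    by (intro continuous_intros linear_continuous_on_compose[OF _ linear])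
  ultimately obtain p where p: "p \<in> ?K" "\<And>y. y \<in> ?K \<Longrightarrow> energy (v - p) \<le> energy (v - y)"
    using continuous_attains_inf[of ?K "\<lambda>y. energy (v - y)"] y0K by blast
  have "energy (v - p) \<le> energy (v - y)" if y: "y \<in> C" for y
  proof (cases "y \<in> ?K")
    case False
    then have "energy (v - y0) / c < norm (v - y)" using y by (simp add: dist_norm)
    then have "energy (v - y0) < c * norm (v - y)" using c(1) by (simp add: field_simps)
    then show ?thesis using c(2)[OF vC[OF y]] p(2)[OF y0K] by linarith
  qed (rule p)
  then show thesis using that[of p] p(1) by (simp add: energy_def)
qed

end

lemma posdef_on_form: "posdef_on S P \<Longrightarrow> subspace S \<Longrightarrow> posdef_form S ((*v) P)"
  by (intro posdef_form.intro matrix_vector_mul_linear) (auto simp: posdef_on_def)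

lemma posdef_inverse:
  fixes P :: "real^'n^'n"
  assumes P: "posdef_on UNIV P"
  shows "P *v (matrix_inv P *v v) = v" "matrix_inv P *v (P *v v) = v" "posdef_on UNIV (matrix_inv P)"
proof -
  have "v = 0" if "P *v v = 0" for v
    using P[unfolded posdef_on_def, THEN conjunct2, rule_format, of v] that by fastforce
  then have "invertible P" unfolding invertible_left_inverse matrix_left_invertible_ker by blast
  then have "P ** matrix_inv P = mat 1 \<and> matrix_inv P ** P = mat 1"
    unfolding invertible_def matrix_inv_def by (rule someI_ex)
  then show PQ: "P *v (matrix_inv P *v v) = v" and QP: "matrix_inv P *v (P *v v) = v" for v
    by (simp_all add: matrix_vector_mul_assoc)
  show "posdef_on UNIV (matrix_inv P)"
    unfolding posdef_on_def
  proof (intro conjI ballI impI)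
    fix u v
    have "(P *v (matrix_inv P *v u)) \<bullet> (matrix_inv P *v v) = (matrix_inv P *v u) \<bullet> (P *v (matrix_inv P *v v))"
      using P unfolding posdef_on_def by (metis UNIV_I)
    then show "u \<bullet> (matrix_inv P *v v) = (matrix_inv P *v u) \<bullet> v" by (simp add: PQ)
  next
    fix v :: "real^'n" assume "v \<noteq> 0"
    then have "matrix_inv P *v v \<noteq> 0" using PQ[of v] by auto
    then have "0 < (matrix_inv P *v v) \<bullet> (P *v (matrix_inv P *v v))"
      using P unfolding posdef_on_def by blast
    then show "0 < v \<bullet> (matrix_inv P *v v)" unfolding PQ by (simp only: inner_commute)
  qed
qed

text \<open>As \<open>projection\<close> picks some minimizer, existence of a nearest point is needed before its optimality
  condition can be used.\<close>

lemma projection_normal_cone: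
  assumes P: "posdef_on UNIV P" and C: "closed C" "convex C" "C \<noteq> {}"
  shows "P *v (v - projection P C v) \<in> normal_cone C (projection P C v)"
proof -
  interpret posdef_form UNIV "(*v) P" using P by (rule posdef_on_form) simp
  let ?p = "projection P C v"
  obtain q where "q \<in> C" "\<And>y. y \<in> C \<Longrightarrow> (v - q) \<bullet> (P *v (v - q)) \<le> (v - y) \<bullet> (P *v (v - y))"
    using nearest_point_exists[OF C(1,3), of v] by auto
  then have "is_arg_min (\<lambda>y. 1/2 * sqnorm P (v - y)) (\<lambda>y. y \<in> C) q"
    by (auto simp: is_arg_min_def sqnorm_def not_less)
  then have "is_arg_min (\<lambda>y. 1/2 * sqnorm P (v - y)) (\<lambda>y. y \<in> C) ?p"
    unfolding projection_def arg_min_def by (rule someI)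
  then have p: "?p \<in> C" and "\<And>y. y \<in> C \<Longrightarrow> (v - ?p) \<bullet> (P *v (v - ?p)) \<le> (v - y) \<bullet> (P *v (v - y))"
    by (auto simp: is_arg_min_def sqnorm_def not_less)
  moreover have "(v - y) \<bullet> (P *v (v - y)) = (y - v) \<bullet> (P *v (y - v))" for y
    by (simp add: matrix_vector_mult_diff_distrib inner_diff_left inner_diff_right)
  ultimately have min: "(?p - v) \<bullet> (P *v (?p - v)) \<le> (y - v) \<bullet> (P *v (y - v))" if "y \<in> C" for y
    using that by simp
  have "- (P *v (?p - v)) \<bullet> (y - ?p) \<le> 0" if y: "y \<in> C" for y
    using minimizer_subgradient[OF C(2) _ _ convex_on_const[THEN iffD2, OF C(2), of 0] p y, of v 0] min by simp
  moreover have "- (P *v (?p - v)) = P *v (v - ?p)"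
    by (simp add: matrix_vector_mult_diff_distrib)
  ultimately show ?thesis using p by (simp add: normal_cone_def)
qed

text \<open>Projections are nonexpansive in their own metric; in the Euclidean norm a condition number appears.\<close>

lemma projection_lipschitz:
  assumes P: "posdef_on UNIV P" and C: "closed C" "convex C" "C \<noteq> {}"
  obtains K where "0 \<le> K"
    "\<And>u v. norm (projection P C u - projection P C v) \<le> K * norm (u - v)"
proof -
  interpret posdef_form UNIV "(*v) P" using P by (rule posdef_on_form) simp
  obtain c where c: "0 < c" "\<And>v. c * norm v \<le> energy v" using norm_le_energy by auto
  obtain D where D: "0 < D" "\<And>v. energy v \<le> D * norm v" using energy_le_norm by auto
  have "norm (projection P C u - projection P C v) \<le> D / c * norm (u - v)" for u v
  proof -
    let ?p = "projection P C u" and ?q = "projection P C v"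
    have "0 \<le> (P *v (u - ?p) - P *v (v - ?q)) \<bullet> (?p - ?q)"
      by (rule normal_cone_monotone[unfolded monotone_operator_def, rule_format,
            OF projection_normal_cone[OF assms] projection_normal_cone[OF assms]])
    also have "P *v (u - ?p) - P *v (v - ?q) = P *v (u - v) - P *v (?p - ?q)"
      by (simp add: matrix_vector_mult_diff_distrib)
    finally have "(?p - ?q) \<bullet> (P *v (?p - ?q)) \<le> (?p - ?q) \<bullet> (P *v (u - v))"
      by (simp only: inner_diff_left[of "P *v (u - v)"] inner_commute[of "?p - ?q"])
    also have "\<dots> \<le> energy (u - v) * energy (?p - ?q)"
      by (rule cauchy_schwarz) simp_all
    finally have "energy (?p - ?q) * energy (?p - ?q) \<le> energy (u - v) * energy (?p - ?q)"
      unfolding power2_eq_square[symmetric] by (simp only: energy_square UNIV_I)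
    then have "energy (?p - ?q) \<le> energy (u - v)"
      using energy_nonneg[of "u - v"] energy_nonneg[of "?p - ?q"]
      by (cases "energy (?p - ?q) = 0") auto
    then have "c * norm (?p - ?q) \<le> D * norm (u - v)"
      using c(2)[of "?p - ?q"] D(2)[of "u - v"] by linarith
    then show ?thesis using c(1) by (simp add: field_simps)
  qed
  then show thesis using that[of "D / c"] c(1) D(1) by simp
qed

section \<open>Multipliers for linear constraints\<close>

lemma nonneg_slope:
  fixes a c :: real
  assumes "\<And>k. 0 \<le> k \<Longrightarrow> 0 \<le> a + k * c"
  shows "0 \<le> c"
proof (rule ccontr)
  assume "\<not> 0 \<le> c"
  then have c: "c < 0" by simp
  have "0 \<le> a + ((\<bar>a\<bar> + 1) / - c) * c" using c by (intro assms divide_nonneg_pos) auto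
  then show False using c by simp
qed

text \<open>The set \<open>D\<close> of pairs \<open>(s, t)\<close> such that some \<open>y \<in> C\<close> violates the constraints by at most \<open>s\<close> and
  improves the linear objective to below \<open>t\<close> is convex, and optimality of \<open>x\<close> keeps \<open>0\<close> out of it.  A
  separating functional has nonnegative components as \<open>D\<close> is upward closed, and the Slater point
  \<open>y0\<close> excludes that the component of the objective vanishes.\<close>

lemma Slater_multipliers:
  fixes A :: "real^'n^'m" and C :: "(real^'n) set"
  assumes C: "convex C" and y0: "y0 \<in> C" "\<And>r. (A *v y0) $ r < b $ r"
    and x: "x \<in> C" "A *v x \<le> b"
    and opt: "\<And>y. \<lbrakk>y \<in> C; A *v y \<le> b\<rbrakk> \<Longrightarrow> 0 \<le> l \<bullet> (y - x)"
  obtains \<nu> where "0 \<le> \<nu>" "\<nu> \<bullet> (A *v x - b) = 0" "- (l + transpose A *v \<nu>) \<in> normal_cone C x"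
proof -
  define D where "D = {(s, t::real). \<exists>y\<in>C. A *v y - b \<le> s \<and> l \<bullet> (y - x) < t}"
  have "0 \<notin> D"
    using opt by (force simp: D_def zero_prod_def)
  moreover have "convex D"
  proof (rule convexI)
    fix p q :: "(real^'m) \<times> real" and u v :: real
    assume p: "p \<in> D" and q: "q \<in> D" and uv: "0 \<le> u" "0 \<le> v" "u + v = 1"
    obtain s t s' t' where pq: "p = (s, t)" "q = (s', t')" by fastforce
    obtain y y' where y: "y \<in> C" "A *v y - b \<le> s" "l \<bullet> (y - x) < t"
      and y': "y' \<in> C" "A *v y' - b \<le> s'" "l \<bullet> (y' - x) < t'"
      using p q by (auto simp: D_def pq)
    let ?z = "u *\<^sub>R y + v *\<^sub>R y'"
    have v: "v = 1 - u" using uv by simp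
    have "?z \<in> C" using C y y' uv by (simp add: convexD)
    moreover have "A *v ?z - b \<le> u *\<^sub>R s + v *\<^sub>R s'"
    proof -
      have "A *v ?z - b = u *\<^sub>R (A *v y - b) + v *\<^sub>R (A *v y' - b)"
        by (simp add: v matrix_vector_right_distrib matrix_vector_mult_scaleR algebra_simps)
      also have "\<dots> \<le> u *\<^sub>R s + v *\<^sub>R s'"
        using y(2) y'(2) uv by (intro add_mono scaleR_left_mono)
      finally show ?thesis .
    qed
    moreover have "l \<bullet> (?z - x) < u * t + v * t'"
    proof -
      have "l \<bullet> (?z - x) = u * (l \<bullet> (y - x)) + v * (l \<bullet> (y' - x))"
        by (simp add: v inner_diff_right inner_add_right algebra_simps)
      also have "\<dots> < u * t + v * t'"
      proof (cases "u = 0")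
        case False
        then show ?thesis using y(3) y'(3) uv by (intro add_less_le_mono mult_strict_left_mono mult_left_mono) auto
      qed (use y'(3) uv in simp)
      finally show ?thesis .
    qed
    ultimately show "u *\<^sub>R p + v *\<^sub>R q \<in> D" by (auto simp: D_def pq)
  qed
  ultimately have "\<exists>a. a \<noteq> 0 \<and> (\<forall>d\<in>D. 0 \<le> a \<bullet> d)"
    by (intro separating_hyperplane_set_0)
  then obtain a where a: "a \<noteq> 0" "\<And>d. d \<in> D \<Longrightarrow> 0 \<le> a \<bullet> d" by blast
  obtain \<eta> \<tau> where a_eq: "a = (\<eta>, \<tau>)" by fastforce
  have sep: "0 \<le> \<eta> \<bullet> s + \<tau> * t" if "y \<in> C" "A *v y - b \<le> s" "l \<bullet> (y - x) < t" for y s t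
    using a(2)[of "(s, t)"] that by (auto simp: a_eq D_def)
  have eta: "0 \<le> \<eta>"
    unfolding less_eq_vec_def
  proof
    fix r
    (* D contains a ray in the direction of each unit vector. *)
    have "0 \<le> \<eta> \<bullet> (A *v x - b) + \<tau> + k * \<eta> $ r" if k: "0 \<le> k" for k
    proof -
      have "(0 :: real^'m) \<le> axis r k" using k by (simp add: less_eq_vec_def axis_def)
      then show ?thesis
        using sep[of x "A *v x - b + axis r k" 1] x(1) by (simp add: inner_add_right inner_axis ac_simps)
    qed
    then have "0 \<le> \<eta> $ r" by (rule nonneg_slope)
    then show "0 $ r \<le> \<eta> $ r" by simp
  qed
  have "0 \<le> \<eta> \<bullet> (A *v x - b) + \<tau> + k * \<tau>" if "0 \<le> k" for k
    using sep[of x "A *v x - b" "1 + k"] x that by (simp add: algebra_simps)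
  then have tau: "0 \<le> \<tau>" by (rule nonneg_slope)
  have ineq: "0 \<le> \<eta> \<bullet> (A *v y - b) + \<tau> * (l \<bullet> (y - x))" if y: "y \<in> C" for y
  proof -
    have "- (\<eta> \<bullet> (A *v y - b) + \<tau> * (l \<bullet> (y - x))) \<le> t * \<tau>" if "0 < t" for t
      using sep[OF y order_refl, of "l \<bullet> (y - x) + t"] that by (simp add: algebra_simps)
    from le_zero_if_le_scaled[OF this] show ?thesis by simp
  qed
  have "\<tau> \<noteq> 0"
  proof
    assume "\<tau> = 0"
    then have "\<eta> \<noteq> 0" using a(1) a_eq by (auto simp: zero_prod_def)
    then obtain r where r: "\<eta> $ r \<noteq> 0" by (auto simp: vec_eq_iff)
    have nn: "0 \<le> \<eta> $ r * (b - A *v y0) $ r" for r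
      using eta y0(2)[of r] by (simp add: less_eq_vec_def)
    have "0 < \<eta> $ r * (b - A *v y0) $ r"
      using eta y0(2)[of r] r by (simp add: less_eq_vec_def order_less_le)
    then have "0 < \<eta> \<bullet> (b - A *v y0)"
      unfolding inner_vec_def inner_real_def using nn by (intro sum_pos2[of UNIV r]) auto
    then show False using ineq[OF y0(1)] \<open>\<tau> = 0\<close> by (simp add: inner_diff_right)
  qed
  then have tau': "0 < \<tau>" using tau by simp
  define \<nu> where "\<nu> = (1 / \<tau>) *\<^sub>R \<eta>"
  have nu: "0 \<le> \<nu>" unfolding \<nu>_def using eta tau by (simp add: less_eq_vec_def)
  have dual: "0 \<le> \<nu> \<bullet> (A *v y - b) + l \<bullet> (y - x)" if "y \<in> C" for y
    using ineq[OF that] tau' by (simp add: \<nu>_def field_simps)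
  have "\<nu> \<bullet> (A *v x - b) \<le> 0"
    unfolding inner_vec_def using nu x(2)
    by (intro sum_nonpos) (simp add: less_eq_vec_def mult_nonneg_nonpos)
  then have compl: "\<nu> \<bullet> (A *v x - b) = 0" using dual[OF x(1)] by simp
  have "- (l + transpose A *v \<nu>) \<bullet> (y - x) \<le> 0" if y: "y \<in> C" for y
  proof -
    have "(transpose A *v \<nu>) \<bullet> (y - x) = \<nu> \<bullet> (A *v y - b) - \<nu> \<bullet> (A *v x - b)"
      by (simp add: dot_lmul_matrix[symmetric] matrix_vector_mult_diff_distrib inner_diff_right)
    then show ?thesis using dual[OF y] compl by (simp add: inner_add_left inner_diff_left)
  qed
  then show thesis using that[OF nu compl] x(1) by (simp add: normal_cone_def)
qed

lemma vec_le_component: "u \<le> v \<Longrightarrow> u $ r \<le> v $ r"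
  by (simp add: less_eq_vec_def)

text \<open>An interior point of the feasible set satisfies every constraint with a nonzero row strictly.  A zero
  row may be tight everywhere, so its right-hand side is raised by \<open>1\<close>: the feasible set
  stays the same, the interior point becomes a Slater point, and complementary slackness forces the
  multiplier of such a row to vanish, which makes it valid for the original right-hand side as well.\<close>

lemma multipliers_of_solid_constraint_set:
  fixes A :: "real^'n^'m" and C :: "(real^'n) set"
  assumes C: "convex C" and int: "interior (C \<inter> {y. A *v y \<le> b}) \<noteq> {}"
    and x: "x \<in> C" "A *v x \<le> b"
    and opt: "\<And>y. \<lbrakk>y \<in> C; A *v y \<le> b\<rbrakk> \<Longrightarrow> 0 \<le> l \<bullet> (y - x)"
  obtains \<nu> where "0 \<le> \<nu>" "\<nu> \<bullet> (A *v x - b) = 0" "- (l + transpose A *v \<nu>) \<in> normal_cone C x"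
proof -
  obtain y0 e where e: "0 < e" "ball y0 e \<subseteq> C \<inter> {y. A *v y \<le> b}"
    using int by (metis all_not_in_conv mem_interior)
  then have "y0 \<in> C \<inter> {y. A *v y \<le> b}" using centre_in_ball by blast
  then have y0: "y0 \<in> C" "A *v y0 \<le> b" by auto
  have strict: "(A *v y0) $ r < b $ r" if "A $ r \<noteq> 0" for r
  proof -
    (* A step along the row itself increases the left-hand side within the ball. *)
    let ?d = "(e / 2 / norm (A $ r)) *\<^sub>R A $ r"
    have "y0 + ?d \<in> ball y0 e" using e(1) that by (simp add: dist_norm)
    then have "(A *v (y0 + ?d)) $ r \<le> b $ r" using e(2) by (auto simp: less_eq_vec_def)
    moreover have "0 < A $ r \<bullet> ?d" using e(1) that by simp
    ultimately show ?thesis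
      by (simp only: matrix_vector_mul_component inner_add_right)
  qed
  define b' where "b' = (\<chi> r. if A $ r = 0 then b $ r + 1 else b $ r)"
  have zero_row: "(A *v y) $ r = 0" if "A $ r = 0" for y r
    using that by (simp add: matrix_vector_mul_component)
  have b0: "0 \<le> b $ r" if "A $ r = 0" for r
    using vec_le_component[OF y0(2), of r] zero_row[OF that, of y0] by simp
  have b'_le: "A *v y \<le> b' \<longleftrightarrow> A *v y \<le> b" for y
    unfolding less_eq_vec_def
  proof (rule all_cong1)
    fix r show "(A *v y) $ r \<le> b' $ r \<longleftrightarrow> (A *v y) $ r \<le> b $ r"
      using zero_row[of r y] b0[of r] by (simp add: b'_def)
  qed
  have "(A *v y0) $ r < b' $ r" for r
    using strict[of r] zero_row[of r y0] b0[of r] by (auto simp: b'_def)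
  then obtain \<nu> where nu: "0 \<le> \<nu>" "\<nu> \<bullet> (A *v x - b') = 0" "- (l + transpose A *v \<nu>) \<in> normal_cone C x"
    using Slater_multipliers[OF C y0(1), of A b' x l] x opt b'_le by blast
  have nn: "0 \<le> \<nu> $ r * (b' - A *v x) $ r" for r
    using nu(1) x(2) b'_le[of x] by (simp add: less_eq_vec_def)
  have "(\<Sum>r\<in>UNIV. \<nu> $ r * (b' - A *v x) $ r) = 0"
    using nu(2) by (simp add: inner_vec_def inner_diff_right sum_subtractf right_diff_distrib)
  then have zero: "\<nu> $ r * (b' - A *v x) $ r = 0" for r
    using sum_nonneg_eq_0_iff[of UNIV "\<lambda>r. \<nu> $ r * (b' - A *v x) $ r"] nn by simp
  have "\<nu> $ r * (A *v x - b) $ r = 0" for r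
  proof (cases "A $ r = 0")
    case True
    then show ?thesis using zero[of r] b0[of r] zero_row[OF True, of x] by (simp add: b'_def)
  next
    case False
    then show ?thesis using zero[of r] by (auto simp: b'_def)
  qed
  then have "\<nu> \<bullet> (A *v x - b) = 0" unfolding inner_vec_def inner_real_def by (intro sum.neutral) blast
  then show thesis using that nu by blast
qed

section \<open>Consensus and flows on a connected graph\<close>

lemma incidence_eq:
  assumes "oriented_graph G"
  shows "incidence G $ i $ l = (if l \<in> arcs G then of_bool (head G l = i) - of_bool (tail G l = i) else 0)"
proof -
  interpret loopfree_digraph G using assms by (simp add: oriented_graph_def)
  show ?thesis using no_loops[of l] by (auto simp: incidence_def in_arcs_def out_arcs_def)
qed

lemma Vbar_mult:
  "(Vbar G *v Z) $ (i, r) = (\<Sum>l\<in>UNIV. incidence G $ i $ l * Z $ (l, r))"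
proof -
  have "(Vbar G *v Z) $ (i, r) = (\<Sum>q\<in>UNIV \<times> UNIV. incidence G $ i $ fst q * mat 1 $ r $ snd q * Z $ q)"
    by (simp add: matrix_vector_mult_def Vbar_def kron_def)
  also have "\<dots> = (\<Sum>l\<in>UNIV. \<Sum>s\<in>UNIV. if r = s then incidence G $ i $ l * Z $ (l, s) else 0)"
    unfolding sum.cartesian_product' by (intro sum.cong) (auto simp: mat_def)
  finally show ?thesis by simp
qed

lemma transpose_Vbar_mult:
  assumes "oriented_graph G"
  shows "(transpose (Vbar G) *v L) $ (l, r) = (if l \<in> arcs G then L $ (head G l, r) - L $ (tail G l, r) else 0)"
proof -
  have "(transpose (Vbar G) *v L) $ (l, r) = (\<Sum>q\<in>UNIV \<times> UNIV. incidence G $ fst q $ l * mat 1 $ snd q $ r * L $ q)"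
    by (simp add: matrix_vector_mult_def transpose_def Vbar_def kron_def)
  also have "\<dots> = (\<Sum>i\<in>UNIV. \<Sum>s\<in>UNIV. if s = r then incidence G $ i $ l * L $ (i, s) else 0)"
    unfolding sum.cartesian_product' by (intro sum.cong) (auto simp: mat_def)
  also have "\<dots> = (\<Sum>i\<in>UNIV. incidence G $ i $ l * L $ (i, r))" by simp
  also have "\<dots> = (\<Sum>i\<in>UNIV. (if i = head G l then of_bool (l \<in> arcs G) * L $ (i, r) else 0)
      - (if i = tail G l then of_bool (l \<in> arcs G) * L $ (i, r) else 0))"
    by (intro sum.cong) (auto simp: incidence_eq[OF assms])
  also have "\<dots> = (if l \<in> arcs G then L $ (head G l, r) - L $ (tail G l, r) else 0)"
    by (subst sum_subtractf) simp
  finally show ?thesis .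
qed

text \<open>The kernel of the transposed incidence matrix consists of the vectors that are constant along edges,
  hence constant along paths.\<close>

lemma consensus:
  assumes G: "oriented_graph G" "Digraph_Component.connected G"
    and L: "transpose (Vbar G) *v L = 0"
  obtains l where "L = kron_vec (\<chi> i. 1) l"
proof -
  have edge: "L $ (head G e, r) = L $ (tail G e, r)" if "e \<in> arcs G" for e r
    using transpose_Vbar_mult[OF G(1), of L e r] that L by simp
  have "L $ (i, r) = L $ (j, r)" for i j r
  proof -
    have "(i, j) \<in> rtrancl_on UNIV (parcs (mk_symmetric G))"
      using G by (auto simp: connected_def strongly_connected_def oriented_graph_def reachable_def)
    then show ?thesis
      by induct (auto simp: mk_symmetric_def edge)
  qed
  then have "L $ q = kron_vec (\<chi> i. 1) (\<chi> r. L $ (undefined, r)) $ q" for q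
    by (cases q) (simp add: kron_vec_def)
  then have "L = kron_vec (\<chi> i. 1) (\<chi> r. L $ (undefined, r))"
    unfolding vec_eq_iff by blast
  then show thesis by (rule that)
qed

text \<open>The range of a matrix is the orthogonal complement of the kernel of its transpose, which consists of the
  consensus vectors; being orthogonal to these means summing to zero over the vertices.\<close>

lemma range_Vbar:
  assumes G: "oriented_graph G" "Digraph_Component.connected G"
    and u: "\<And>r. (\<Sum>i\<in>UNIV. u $ (i, r)) = 0"
  obtains z where "Vbar G *v edge_col G z = u"
proof -
  obtain y q where y: "y \<in> span (range ((*v) (Vbar G)))"
    and q: "\<And>w. w \<in> span (range ((*v) (Vbar G))) \<Longrightarrow> orthogonal q w" and u_eq: "u = y + q"
    using orthogonal_subspace_decomp_exists[of "range ((*v) (Vbar G))" u] by metis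
  have "(transpose (Vbar G) *v q) \<bullet> w = 0" for w
    using q[OF span_base, OF rangeI, of w] by (simp add: orthogonal_def dot_lmul_matrix)
  from this[of "transpose (Vbar G) *v q"] have "transpose (Vbar G) *v q = 0" by simp
  then obtain l where l: "q = kron_vec (\<chi> i. 1) l" by (rule consensus[OF G])
  have "q \<bullet> u = (\<Sum>p\<in>UNIV \<times> UNIV. l $ snd p * u $ p)"
    by (simp add: inner_vec_def l kron_vec_def)
  also have "\<dots> = (\<Sum>r\<in>UNIV. \<Sum>i\<in>UNIV. l $ r * u $ (i, r))"
    unfolding sum.cartesian_product' snd_conv by (rule sum.swap)
  also have "\<dots> = 0" by (simp add: sum_distrib_left[symmetric] u)
  finally have "q = 0" using q[OF y] by (simp add: u_eq inner_add_right orthogonal_def)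
  moreover have "subspace (range ((*v) (Vbar G)))"
    by (intro linear_subspace_image matrix_vector_mul_linear subspace_UNIV)
  then have "y \<in> range ((*v) (Vbar G))" using y by (metis span_eq_iff)
  ultimately obtain Z where Z: "u = Vbar G *v Z" using u_eq by auto
  (* Values at unused edge names are discarded; they meet zero columns of the incidence matrix. *)
  let ?z = "\<lambda>l. \<chi> r. Z $ (l, r)"
  have "(Vbar G *v edge_col G ?z) $ p = (Vbar G *v Z) $ p" for p
    by (cases p) (auto simp: Vbar_mult edge_col_def col_def incidence_eq[OF G(1)] intro!: sum.cong)
  then show thesis using that[of ?z] Z by (simp add: vec_eq_iff)
qed

section \<open>The game and its KKT operator\<close>

lemma own_nth: "own \<Gamma> i x $ c = (if owner \<Gamma> c = i then x $ c else 0)"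
  by (simp add: own_def)

lemma deviate_nth: "deviate \<Gamma> i y x $ c = (if owner \<Gamma> c = i then y $ c else x $ c)"
  by (simp add: deviate_def)

lemma linear_own: "linear (own \<Gamma> i)"
  by (intro linearI) (simp_all add: vec_eq_iff own_nth)

lemmas own_diff = linear_diff[OF linear_own] and own_add = linear_add[OF linear_own]
  and own_scale = linear_cmul[OF linear_own]

lemma subspace_pspace: "subspace (pspace \<Gamma> i)"
  by (auto simp: subspace_def pspace_def)

lemma own_in_pspace: "own \<Gamma> i x \<in> pspace \<Gamma> i"
  by (simp add: pspace_def own_nth)

lemma own_pspace: "y \<in> pspace \<Gamma> i \<Longrightarrow> own \<Gamma> i y = y"
  by (auto simp: pspace_def own_nth vec_eq_iff)

lemma own_deviate: "own \<Gamma> j (deviate \<Gamma> i y x) = (if j = i then own \<Gamma> i y else own \<Gamma> j x)"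
  by (auto simp: vec_eq_iff own_nth deviate_nth)

lemma deviate_own: "deviate \<Gamma> i (own \<Gamma> i x) x = x"
  by (simp add: vec_eq_iff own_nth deviate_nth)

lemma deviate_diff: "y \<in> pspace \<Gamma> i \<Longrightarrow> deviate \<Gamma> i y x - x = y - own \<Gamma> i x"
  by (auto simp: vec_eq_iff own_nth deviate_nth pspace_def)

lemma inner_own:
  assumes "y \<in> pspace \<Gamma> i"
  shows "own \<Gamma> i g \<bullet> y = g \<bullet> y"
  unfolding inner_vec_def using assms by (intro sum.cong) (auto simp: own_nth pspace_def)

lemma regular_strat:
  assumes "regular_game \<Gamma>"
  shows "strat \<Gamma> i \<subseteq> pspace \<Gamma> i" "convex (strat \<Gamma> i)"
  using assms unfolding regular_game_def by blast+

lemma profiles_deviate: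
  assumes "x \<in> profiles \<Gamma>" "y \<in> strat \<Gamma> i" "strat \<Gamma> i \<subseteq> pspace \<Gamma> i"
  shows "deviate \<Gamma> i y x \<in> profiles \<Gamma>"
  using assms own_pspace by (fastforce simp: profiles_def own_deviate)

text \<open>Differences of strategies of one player see only that player's part of \<open>g\<close>, so the subgradient
  inequalities of all players can be stated with a single vector and real-valued costs.\<close>

lemma mem_pseudo_subdiff_iff:
  assumes "\<And>i. strat \<Gamma> i \<subseteq> pspace \<Gamma> i"
  shows "g \<in> pseudo_subdiff \<Gamma> x \<longleftrightarrow> x \<in> profiles \<Gamma> \<and>
    (\<forall>i. \<forall>y\<in>strat \<Gamma> i. cost \<Gamma> i x + g \<bullet> (y - own \<Gamma> i x) \<le> cost \<Gamma> i (deviate \<Gamma> i y x))"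
proof -
  have dom: "edom (section_cost \<Gamma> i x) = strat \<Gamma> i" for i
    by (auto simp: edom_def section_cost_def)
  have "own \<Gamma> i g \<in> partial_subdiff \<Gamma> i x \<longleftrightarrow> own \<Gamma> i x \<in> strat \<Gamma> i \<and>
      (\<forall>y\<in>strat \<Gamma> i. cost \<Gamma> i x + g \<bullet> (y - own \<Gamma> i x) \<le> cost \<Gamma> i (deviate \<Gamma> i y x))" for i
  proof -
    have "own \<Gamma> i g \<bullet> (y - own \<Gamma> i x) = g \<bullet> (y - own \<Gamma> i x)" if "y \<in> strat \<Gamma> i" for y
      using that assms own_in_pspace by (intro inner_own subspace_diff subspace_pspace) auto
    then show ?thesis
      by (auto simp: partial_subdiff_def subdifferential_def dom own_in_pspace section_cost_def deviate_own)
  qed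
  then show ?thesis by (auto simp: pseudo_subdiff_def profiles_def)
qed

text \<open>A player's cost is infinite outside the strategy set, so its subdifferential is closed under adding
  normal vectors of that set; unilateral deviations stay within the product set.\<close>

lemma normal_cone_absorbed:
  assumes strat: "\<And>i. strat \<Gamma> i \<subseteq> pspace \<Gamma> i"
    and u: "u \<in> normal_cone (profiles \<Gamma>) x" and g: "g \<in> pseudo_subdiff \<Gamma> x"
  shows "u + g \<in> pseudo_subdiff \<Gamma> x"
  unfolding mem_pseudo_subdiff_iff[OF strat]
proof (intro conjI allI ballI)
  show x: "x \<in> profiles \<Gamma>" using g mem_pseudo_subdiff_iff[OF strat] by blast
  fix i y assume y: "y \<in> strat \<Gamma> i"
  have "u \<bullet> (deviate \<Gamma> i y x - x) \<le> 0"
    using u x profiles_deviate[OF x y strat] by (simp add: normal_cone_def)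
  then have "u \<bullet> (y - own \<Gamma> i x) \<le> 0"
    using y strat deviate_diff by (metis subsetD)
  moreover have "cost \<Gamma> i x + g \<bullet> (y - own \<Gamma> i x) \<le> cost \<Gamma> i (deviate \<Gamma> i y x)"
    using g y mem_pseudo_subdiff_iff[OF strat] by blast
  ultimately show "cost \<Gamma> i x + (u + g) \<bullet> (y - own \<Gamma> i x) \<le> cost \<Gamma> i (deviate \<Gamma> i y x)"
    by (simp add: inner_add_left)
qed

text \<open>By absorption the normal cone of the product set can be taken to contribute \<open>0\<close>, and membership splits into
  three independent conditions.  Each of them is closed under limits.\<close>

lemma mem_KKT_operator_iff:
  assumes strat: "\<And>i. strat \<Gamma> i \<subseteq> pspace \<Gamma> i"
  shows "(a, b, c) \<in> KKT_operator \<Gamma> G (x, Z, L) \<longleftrightarrow>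
    a - transpose (Lambda \<Gamma>) *v L \<in> pseudo_subdiff \<Gamma> x \<and> b = transpose (Vbar G) *v L \<and>
    c + Lambda \<Gamma> *v x + Vbar G *v Z - col (cvec \<Gamma>) \<in> normal_cone orthant L"
  (is "?K \<longleftrightarrow> ?R")
proof
  assume ?K
  then obtain u g w where eq: "a = transpose (Lambda \<Gamma>) *v L + (u + g)" "b = transpose (Vbar G) *v L"
      "c = - (Lambda \<Gamma> *v x) - Vbar G *v Z + col (cvec \<Gamma>) + w"
    and mem: "u \<in> normal_cone (profiles \<Gamma>) x" "g \<in> pseudo_subdiff \<Gamma> x" "w \<in> normal_cone orthant L"
    unfolding KKT_operator_def by auto
  have "a - transpose (Lambda \<Gamma>) *v L = u + g"
    "c + Lambda \<Gamma> *v x + Vbar G *v Z - col (cvec \<Gamma>) = w"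
    unfolding eq by (simp_all only: diff_conv_add_uminus add.assoc) simp_all
  then show ?R using normal_cone_absorbed[OF strat mem(1,2)] mem(3) eq(2) by simp
next
  assume R: ?R
  then have "x \<in> profiles \<Gamma>" using mem_pseudo_subdiff_iff[OF strat] by blast
  then have "0 \<in> normal_cone (profiles \<Gamma>) x" by (simp add: normal_cone_def)
  moreover have "a = transpose (Lambda \<Gamma>) *v L + (0 + (a - transpose (Lambda \<Gamma>) *v L))"
    "c = - (Lambda \<Gamma> *v x) - Vbar G *v Z + col (cvec \<Gamma>) + (c + Lambda \<Gamma> *v x + Vbar G *v Z - col (cvec \<Gamma>))"
    by simp_all
  ultimately show ?K using R unfolding KKT_operator_def prod.case by blast
qed

lemma inner_transpose: "(transpose (A :: real^'n^'m) *v u) \<bullet> v = u \<bullet> (A *v v)"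
  by (simp add: dot_lmul_matrix)

text \<open>The linear part of the operator is skew-symmetric and cancels in the inner product.\<close>

lemma KKT_operator_monotone:
  assumes strat: "\<And>i. strat \<Gamma> i \<subseteq> pspace \<Gamma> i" and mono: "monotone_operator (pseudo_subdiff \<Gamma>)"
  shows "monotone_operator (KKT_operator \<Gamma> G)"
  unfolding monotone_operator_def
proof (intro allI ballI)
  fix p q u v assume u: "u \<in> KKT_operator \<Gamma> G p" and v: "v \<in> KKT_operator \<Gamma> G q"
  obtain x Z L x' Z' L' where pq: "p = (x, Z, L)" "q = (x', Z', L')" by (metis prod_cases3)
  obtain a b c a' b' c' where uv: "u = (a, b, c)" "v = (a', b', c')" by (metis prod_cases3)
  note u' = u[unfolded pq uv mem_KKT_operator_iff[OF strat]] and v' = v[unfolded pq uv mem_KKT_operator_iff[OF strat]]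
  let ?L = "transpose (Lambda \<Gamma>)" and ?V = "transpose (Vbar G)"
  have "0 \<le> (a - ?L *v L - (a' - ?L *v L')) \<bullet> (x - x')"
    using mono u' v' unfolding monotone_operator_def by blast
  then have 1: "(?L *v L - ?L *v L') \<bullet> (x - x') \<le> (a - a') \<bullet> (x - x')"
    by (simp only: inner_diff_left)
  have "0 \<le> (c + Lambda \<Gamma> *v x + Vbar G *v Z - col (cvec \<Gamma>) - 
     (c' + Lambda \<Gamma> *v x' + Vbar G *v Z' - col (cvec \<Gamma>))) \<bullet> (L - L')"
    by (rule normal_cone_monotone[unfolded monotone_operator_def, rule_format]) (use u' v' in blast)+
  then have 2: "0 \<le> (c - c') \<bullet> (L - L') + (Lambda \<Gamma> *v (x - x')) \<bullet> (L - L') + (Vbar G *v (Z - Z')) \<bullet> (L - L')"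
    by (simp only: matrix_vector_mult_diff_distrib inner_diff_left inner_add_left)
  have 3: "(?L *v L - ?L *v L') \<bullet> (x - x') = (Lambda \<Gamma> *v (x - x')) \<bullet> (L - L')"
    unfolding matrix_vector_mult_diff_distrib[symmetric] inner_transpose by (rule inner_commute)
  have 4: "(b - b') \<bullet> (Z - Z') = (Vbar G *v (Z - Z')) \<bullet> (L - L')"
    using u' v' by (simp only: matrix_vector_mult_diff_distrib[symmetric] inner_transpose) (rule inner_commute)
  show "0 \<le> (u - v) \<bullet> (p - q)"
    using 1 2 3 4 by (simp add: pq uv inner_prod_def)
qed

lemma KKT_operator_closed:
  assumes strat: "\<And>i. strat \<Gamma> i \<subseteq> pspace \<Gamma> i" and max: "maximally_monotone (pseudo_subdiff \<Gamma>)"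
    and u: "\<And>k. u k \<in> KKT_operator \<Gamma> G (v k)" and lim: "v \<longlonglongrightarrow> p" "u \<longlonglongrightarrow> q"
  shows "q \<in> KKT_operator \<Gamma> G p"
proof -
  obtain x Z L where p: "p = (x, Z, L)" by (metis prod_cases3)
  obtain a b c where q: "q = (a, b, c)" by (metis prod_cases3)
  define x' Z' L' where "x' k = fst (v k)" and "Z' k = fst (snd (v k))" and "L' k = snd (snd (v k))" for k
  define a' b' c' where "a' k = fst (u k)" and "b' k = fst (snd (u k))" and "c' k = snd (snd (u k))" for k
  have v: "v = (\<lambda>k. (x' k, Z' k, L' k))" by (simp add: x'_def Z'_def L'_def)
  have u_eq: "u = (\<lambda>k. (a' k, b' k, c' k))" by (simp add: a'_def b'_def c'_def)
  have l: "x' \<longlonglongrightarrow> x" "Z' \<longlonglongrightarrow> Z" "L' \<longlonglongrightarrow> L"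
    using tendsto_fst[OF lim(1)] tendsto_fst[OF tendsto_snd[OF lim(1)]] tendsto_snd[OF tendsto_snd[OF lim(1)]]
    by (simp_all add: p x'_def[abs_def] Z'_def[abs_def] L'_def[abs_def])
  have m: "a' \<longlonglongrightarrow> a" "b' \<longlonglongrightarrow> b" "c' \<longlonglongrightarrow> c"
    using tendsto_fst[OF lim(2)] tendsto_fst[OF tendsto_snd[OF lim(2)]] tendsto_snd[OF tendsto_snd[OF lim(2)]]
    by (simp_all add: q a'_def[abs_def] b'_def[abs_def] c'_def[abs_def])
  have mat: "(\<lambda>k. A *v y k) \<longlonglongrightarrow> A *v y0" if "y \<longlonglongrightarrow> y0" for A :: "real^'i::finite^'j::finite" and y y0
    using bounded_linear.tendsto[OF matrix_vector_mul_bounded_linear that] .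
  have mem: "a' k - transpose (Lambda \<Gamma>) *v L' k \<in> pseudo_subdiff \<Gamma> (x' k)" "b' k = transpose (Vbar G) *v L' k"
    "c' k + Lambda \<Gamma> *v x' k + Vbar G *v Z' k - col (cvec \<Gamma>) \<in> normal_cone orthant (L' k)" for k
    using u[of k] unfolding v u_eq mem_KKT_operator_iff[OF strat] by blast+
  have "a - transpose (Lambda \<Gamma>) *v L \<in> pseudo_subdiff \<Gamma> x"
    by (rule maximally_monotone_closed_graph[OF max mem(1) l(1)]) (intro tendsto_diff m mat l)
  moreover have "b = transpose (Vbar G) *v L"
    using LIMSEQ_unique[OF m(2)] mat[OF l(3)] unfolding mem(2)[abs_def] by blast
  moreover have "c + Lambda \<Gamma> *v x + Vbar G *v Z - col (cvec \<Gamma>) \<in> normal_cone orthant L"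
    by (rule normal_cone_closed_graph[OF closed_orthant mem(3) l(3)]) (intro tendsto_diff tendsto_add tendsto_const m mat l)
  ultimately show ?thesis unfolding p q mem_KKT_operator_iff[OF strat] by blast
qed

section \<open>Variational equilibria and zeros of the KKT operator\<close>

lemma inner_col: "col u \<bullet> col v = (\<Sum>i\<in>UNIV. u i \<bullet> v i)"
proof -
  have "col u \<bullet> col v = (\<Sum>q\<in>UNIV \<times> UNIV. u (fst q) $ snd q * v (fst q) $ snd q)"
    by (simp add: inner_vec_def col_def)
  then show ?thesis unfolding sum.cartesian_product' by (simp add: inner_vec_def)
qed

lemma col_nth: "col u $ (i, r) = u i $ r"
  by (simp add: col_def)

lemma col_diff: "col (\<lambda>i. u i - v i) = col u - col v"
  by (simp add: col_def vec_eq_iff)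

lemma col_add: "col (\<lambda>i. u i + v i) = col u + col v"
  by (simp add: col_def vec_eq_iff)

lemma kron_vec_ones: "kron_vec (\<chi> i. 1) l = col (\<lambda>i. l)"
  by (simp add: kron_vec_def col_def vec_eq_iff)

lemma Lambda_mult: "Lambda \<Gamma> *v x = col (\<lambda>i. cmat \<Gamma> i *v own \<Gamma> i x)"
  by (auto simp: vec_eq_iff Lambda_def col_def matrix_vector_mult_def own_nth intro!: sum.cong)

text \<open>Horizontal concatenation of the players' constraint matrices, so that the shared constraint is a
  single linear system.\<close>

definition total_matrix :: "('p::finite, 'c::finite, 'm::finite) game \<Rightarrow> real^'c^'m" where
  "total_matrix \<Gamma> = (\<chi> r c. cmat \<Gamma> (owner \<Gamma> c) $ r $ c)"

lemma total_matrix_mult: "total_matrix \<Gamma> *v x = (\<Sum>i\<in>UNIV. cmat \<Gamma> i *v own \<Gamma> i x)"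
proof -
  have "(\<Sum>i\<in>UNIV. cmat \<Gamma> i *v own \<Gamma> i x) $ r = (total_matrix \<Gamma> *v x) $ r" for r
  proof -
    have "(\<Sum>i\<in>UNIV. cmat \<Gamma> i *v own \<Gamma> i x) $ r = (\<Sum>i\<in>UNIV. \<Sum>c\<in>UNIV. cmat \<Gamma> i $ r $ c * own \<Gamma> i x $ c)"
      by (simp add: matrix_vector_mult_def)
    also have "\<dots> = (\<Sum>c\<in>UNIV. \<Sum>i\<in>UNIV. if owner \<Gamma> c = i then cmat \<Gamma> i $ r $ c * x $ c else 0)"
      by (subst sum.swap) (intro sum.cong, auto simp: own_nth)
    also have "\<dots> = (total_matrix \<Gamma> *v x) $ r"
      by (simp add: matrix_vector_mult_def total_matrix_def)
    finally show ?thesis .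
  qed
  then show ?thesis by (simp add: vec_eq_iff)
qed

lemma shared_set_eq: "shared_set \<Gamma> = profiles \<Gamma> \<inter> {y. total_matrix \<Gamma> *v y \<le> (\<Sum>i\<in>UNIV. cvec \<Gamma> i)}"
  by (simp add: shared_set_def total_matrix_mult)

lemma kron_ones_Lambda: "kron_vec (\<chi> i. 1) l \<bullet> (Lambda \<Gamma> *v x) = l \<bullet> (total_matrix \<Gamma> *v x)"
  by (simp add: kron_vec_ones Lambda_mult inner_col total_matrix_mult inner_sum_right)

lemma transpose_Vbar_ones:
  assumes "oriented_graph G"
  shows "transpose (Vbar G) *v kron_vec (\<chi> i. 1) l = 0"
proof -
  have "(transpose (Vbar G) *v kron_vec (\<chi> i. 1) l) $ q = 0" for q
    by (cases q) (simp only: transpose_Vbar_mult[OF assms], simp add: kron_vec_def)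
  then show ?thesis by (simp add: vec_eq_iff)
qed

text \<open>Pairing with a consensus vector sums over the players: the edge terms cancel and the residual of the
  shared constraint remains.\<close>

lemma kron_ones_residual:
  assumes "oriented_graph G"
  shows "kron_vec (\<chi> i. 1) l \<bullet> (Lambda \<Gamma> *v x + Vbar G *v Z - col (cvec \<Gamma>))
    = l \<bullet> (total_matrix \<Gamma> *v x - (\<Sum>i\<in>UNIV. cvec \<Gamma> i))"
proof -
  have "kron_vec (\<chi> i. 1) l \<bullet> (Vbar G *v Z) = 0"
    using inner_transpose[of "Vbar G" "kron_vec (\<chi> i. 1) l" Z] by (simp only: transpose_Vbar_ones[OF assms] inner_zero_left)
  moreover have "kron_vec (\<chi> i. 1) l \<bullet> col (cvec \<Gamma>) = l \<bullet> (\<Sum>i\<in>UNIV. cvec \<Gamma> i)"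
    by (simp add: kron_vec_ones inner_col inner_sum_right)
  ultimately show ?thesis by (simp add: inner_diff_right inner_add_right kron_ones_Lambda)
qed

text \<open>A profitable feasible deviation of one player is a point of the shared set that violates the variational
  inequality, by the subgradient inequality of this player.\<close>

lemma GVI_solution_imp_GNE:
  assumes strat: "\<And>i. strat \<Gamma> i \<subseteq> pspace \<Gamma> i" and sol: "GVI_solution \<Gamma> x"
  shows "GNE \<Gamma> x"
  unfolding GNE_def is_arg_min_def
proof (intro allI conjI notI)
  fix i
  obtain l where x: "x \<in> shared_set \<Gamma>" and l: "l \<in> pseudo_subdiff \<Gamma> x"
    and vi: "\<And>y. y \<in> shared_set \<Gamma> \<Longrightarrow> 0 \<le> l \<bullet> (y - x)"
    using sol unfolding GVI_solution_def by blast
  show "own \<Gamma> i x \<in> feasible \<Gamma> i x"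
    using x by (simp add: feasible_def deviate_own shared_set_def profiles_def)
  assume "\<exists>y. y \<in> feasible \<Gamma> i x \<and> cost \<Gamma> i (deviate \<Gamma> i y x) < cost \<Gamma> i (deviate \<Gamma> i (own \<Gamma> i x) x)"
  then obtain y where y: "y \<in> strat \<Gamma> i" "deviate \<Gamma> i y x \<in> shared_set \<Gamma>"
    and less: "cost \<Gamma> i (deviate \<Gamma> i y x) < cost \<Gamma> i x"
    by (auto simp: feasible_def deviate_own)
  have "cost \<Gamma> i x + l \<bullet> (y - own \<Gamma> i x) \<le> cost \<Gamma> i (deviate \<Gamma> i y x)"
    using l y(1) mem_pseudo_subdiff_iff[OF strat] by blast
  moreover have "0 \<le> l \<bullet> (y - own \<Gamma> i x)"
    using vi[OF y(2)] deviate_diff[OF subsetD[OF strat y(1)], of x] by simp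
  ultimately show False using less by simp
qed

text \<open>The residual of the third block is nonpositive and orthogonal to the consensus multiplier.  Pairing it
  with the consensus vector of a unit vector gives one row of the shared constraint, pairing it with the
  multiplier itself gives complementary slackness, and the first block then yields the variational
  inequality by weak duality.\<close>

lemma zer_KKT_imp_GVI_solution:
  fixes \<Gamma> :: "('p::finite, 'c::finite, 'm::finite) game"
  assumes strat: "\<And>i. strat \<Gamma> i \<subseteq> pspace \<Gamma> i"
    and G: "oriented_graph G" "Digraph_Component.connected G"
    and zero: "(x, Z, L) \<in> zer (KKT_operator \<Gamma> G)"
  shows "GVI_solution \<Gamma> x" "\<exists>l. l \<in> orthant \<and> L = kron_vec (\<chi> i. 1) l"
proof -
  let ?w = "Lambda \<Gamma> *v x + Vbar G *v Z - col (cvec \<Gamma>)" and ?b = "\<Sum>i\<in>UNIV. cvec \<Gamma> i"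
  let ?A = "total_matrix \<Gamma>"
  have mem: "- (transpose (Lambda \<Gamma>) *v L) \<in> pseudo_subdiff \<Gamma> x" and V: "transpose (Vbar G) *v L = 0"
    and w: "0 \<le> L" "?w \<le> 0" "?w \<bullet> L = 0"
    using zero mem_KKT_operator_iff[OF strat, of 0 0 0] unfolding normal_cone_orthant_iff
    by (auto simp: zer_def zero_prod_def)
  obtain l where L: "L = kron_vec (\<chi> i. 1) l" using consensus[OF G V] .
  have "0 \<le> l"
    using w(1) by (auto simp: L kron_vec_ones less_eq_vec_def col_nth)
  then show "\<exists>l. l \<in> orthant \<and> L = kron_vec (\<chi> i. 1) l" using L by (auto simp: orthant_def)
  have feas: "?A *v x \<le> ?b"
    unfolding less_eq_vec_def
  proof
    fix r
    have "kron_vec (\<chi> i. 1) (axis r 1) \<bullet> ?w \<le> 0"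
      unfolding inner_vec_def
    proof (rule sum_nonpos)
      fix q :: "'p \<times> 'm"
      have "0 \<le> kron_vec (\<chi> i. 1) (axis r 1) $ q" by (simp add: kron_vec_def axis_def)
      then show "kron_vec (\<chi> i. 1) (axis r 1) $ q \<bullet> ?w $ q \<le> 0"
        using vec_le_component[OF w(2), of q] by (simp only: inner_real_def zero_index mult_nonneg_nonpos)
    qed
    then show "(?A *v x) $ r \<le> ?b $ r"
      unfolding kron_ones_residual[OF G(1)] by (simp add: inner_commute[of "axis r 1"] inner_axis)
  qed
  have compl: "l \<bullet> (?A *v x - ?b) = 0"
    using w(3) unfolding L by (simp only: inner_commute[of ?w] kron_ones_residual[OF G(1)])
  have "x \<in> profiles \<Gamma>" using mem mem_pseudo_subdiff_iff[OF strat] by blast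
  then have "x \<in> shared_set \<Gamma>" using feas by (simp add: shared_set_eq)
  moreover have "0 \<le> - (transpose (Lambda \<Gamma>) *v L) \<bullet> (y - x)" if y: "y \<in> shared_set \<Gamma>" for y
  proof -
    have "?A *v y - ?b \<le> 0" using y by (simp add: shared_set_eq)
    then have "l \<bullet> (?A *v y - ?b) \<le> 0"
      unfolding inner_vec_def inner_real_def
      using \<open>0 \<le> l\<close> by (intro sum_nonpos mult_nonneg_nonpos) (auto dest: vec_le_component)
    moreover have "(transpose (Lambda \<Gamma>) *v L) \<bullet> (y - x) = l \<bullet> (?A *v y - ?b) - l \<bullet> (?A *v x - ?b)"
      unfolding inner_transpose L kron_ones_Lambda
      by (simp add: matrix_vector_mult_diff_distrib inner_diff_right)
    ultimately show ?thesis unfolding inner_minus_left using compl by linarith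
  qed
  ultimately show "GVI_solution \<Gamma> x" using mem unfolding GVI_solution_def by blast
qed

lemma convex_profiles:
  assumes "\<And>i. convex (strat \<Gamma> i)"
  shows "convex (profiles \<Gamma>)"
proof (rule convexI)
  fix x y :: "real^'b" and u v :: real
  assume "x \<in> profiles \<Gamma>" "y \<in> profiles \<Gamma>" "0 \<le> u" "0 \<le> v" "u + v = 1"
  then show "u *\<^sub>R x + v *\<^sub>R y \<in> profiles \<Gamma>"
    using assms by (auto simp: profiles_def own_add own_scale intro: convexD)
qed

text \<open>All players receive the multiplier of the shared constraint, and each of them an equal part of its
  residual as normal vector of the orthant.\<close>

lemma GVI_solution_imp_zer_KKT:
  fixes \<Gamma> :: "('p::finite, 'c::finite, 'm::finite) game"
  assumes reg: "regular_game \<Gamma>"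
    and G: "oriented_graph G" "Digraph_Component.connected G"
    and sol: "GVI_solution \<Gamma> x"
  shows "\<exists>z L. (x, edge_col G z, L) \<in> zer (KKT_operator \<Gamma> G)"
proof -
  note strat = regular_strat(1)[OF reg]
  let ?A = "total_matrix \<Gamma>" and ?b = "\<Sum>i\<in>UNIV. cvec \<Gamma> i" and ?N = "real CARD('p)"
  obtain g where x: "x \<in> profiles \<Gamma>" "?A *v x \<le> ?b" and g: "g \<in> pseudo_subdiff \<Gamma> x"
    and vi: "\<And>y. \<lbrakk>y \<in> profiles \<Gamma>; ?A *v y \<le> ?b\<rbrakk> \<Longrightarrow> 0 \<le> g \<bullet> (y - x)"
    using sol unfolding GVI_solution_def shared_set_eq by blast
  have int: "interior (profiles \<Gamma> \<inter> {y. ?A *v y \<le> ?b}) \<noteq> {}"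
    using reg unfolding regular_game_def shared_set_eq by blast
  obtain \<nu> where nu: "0 \<le> \<nu>" "\<nu> \<bullet> (?A *v x - ?b) = 0"
    and cone: "- (g + transpose ?A *v \<nu>) \<in> normal_cone (profiles \<Gamma>) x"
    using multipliers_of_solid_constraint_set[OF convex_profiles[OF regular_strat(2)[OF reg]] int x vi] by blast
  let ?L = "kron_vec (\<chi> i. 1) \<nu>"
  let ?w = "col (\<lambda>i. (1 / ?N) *\<^sub>R (?A *v x - ?b))"
  have tr: "transpose (Lambda \<Gamma>) *v ?L = transpose ?A *v \<nu>"
    by (rule vector_eq_ldot[THEN iffD1])
       (simp only: inner_commute[of _ "transpose _ *v _"] inner_transpose kron_ones_Lambda simp_thms)
  (* Absorbing the normal vector cancels the subgradient g and leaves the dual term. *)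
  have "- (g + transpose ?A *v \<nu>) + g \<in> pseudo_subdiff \<Gamma> x"
    by (rule normal_cone_absorbed[OF strat cone g])
  then have 1: "- (transpose (Lambda \<Gamma>) *v ?L) \<in> pseudo_subdiff \<Gamma> x"
    unfolding tr by (simp only: minus_add_distrib add.commute[of "- g"] add.assoc left_minus add_0_right)
  have "?w \<le> 0"
    using x(2) by (auto simp: less_eq_vec_def col_nth divide_nonpos_pos)
  moreover have "0 \<le> ?L"
    using nu(1) by (auto simp: kron_vec_ones less_eq_vec_def col_nth)
  moreover have "?w \<bullet> ?L = 0"
    using nu(2) by (simp add: kron_vec_ones inner_col inner_commute)
  ultimately have 2: "?w \<in> normal_cone orthant ?L" by (simp add: normal_cone_orthant_iff)
  have "(\<Sum>i\<in>UNIV. (col (cvec \<Gamma>) + ?w - Lambda \<Gamma> *v x) $ (i, r)) = 0" for r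
  proof -
    have "(?A *v x) $ r = (\<Sum>i\<in>UNIV. (cmat \<Gamma> i *v own \<Gamma> i x) $ r)"
      by (simp add: total_matrix_mult)
    then show ?thesis
      by (simp add: col_nth Lambda_mult sum.distrib sum_subtractf)
  qed
  from range_Vbar[OF G this] obtain z where z: "Vbar G *v edge_col G z = col (cvec \<Gamma>) + ?w - Lambda \<Gamma> *v x" .
  have "(0, 0, 0) \<in> KKT_operator \<Gamma> G (x, edge_col G z, ?L)"
    unfolding mem_KKT_operator_iff[OF strat] z transpose_Vbar_ones[OF G(1)] using 1 2 by simp
  then show ?thesis by (auto simp: zer_def zero_prod_def)
qed

section \<open>One iteration as an inexact resolvent step\<close>

lemma blkdiag_mult: "blkdiag B *v col u = col (\<lambda>i. B i *v u i)"
proof -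
  have "(blkdiag B *v col u) $ (i, r) = (B i *v u i) $ r" for i r
  proof -
    have "(blkdiag B *v col u) $ (i, r)
      = (\<Sum>q\<in>UNIV \<times> UNIV. (if i = fst q then B i $ r $ snd q else 0) * u (fst q) $ snd q)"
      unfolding UNIV_Times_UNIV matrix_vector_mult_def blkdiag_def col_def
      by (simp, intro sum.cong) auto
    also have "\<dots> = (\<Sum>j\<in>UNIV. if i = j then (\<Sum>s\<in>UNIV. B i $ r $ s * u j $ s) else 0)"
      unfolding sum.cartesian_product' by (intro sum.cong) auto
    also have "\<dots> = (B i *v u i) $ r" by (simp add: matrix_vector_mult_def)
    finally show ?thesis .
  qed
  then show ?thesis by (auto simp: vec_eq_iff col_nth)
qed

lemma Rdiag_mult: "own \<Gamma> i (Rdiag \<Gamma> R *v x) = own \<Gamma> i (R i *v own \<Gamma> i x)"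
  by (auto simp: vec_eq_iff own_nth Rdiag_def matrix_vector_mult_def intro!: sum.cong)

lemma own_transpose_Lambda: "own \<Gamma> i (transpose (Lambda \<Gamma>) *v col u) = own \<Gamma> i (transpose (cmat \<Gamma> i) *v u i)"
proof (rule vector_eq_ldot[THEN iffD1], rule allI)
  fix y
  have sym: "y \<bullet> own \<Gamma> i z = z \<bullet> own \<Gamma> i y" for z
    unfolding inner_vec_def by (intro sum.cong) (auto simp: own_nth)
  have other: "own \<Gamma> j (own \<Gamma> i y) = (if j = i then own \<Gamma> i y else 0)" for j
    by (auto simp: vec_eq_iff own_nth)
  have "y \<bullet> own \<Gamma> i (transpose (Lambda \<Gamma>) *v col u) = (\<Sum>j\<in>UNIV. u j \<bullet> (cmat \<Gamma> j *v own \<Gamma> j (own \<Gamma> i y)))"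
    unfolding sym inner_transpose Lambda_mult inner_col ..
  also have "\<dots> = (\<Sum>j\<in>UNIV. if j = i then u i \<bullet> (cmat \<Gamma> i *v own \<Gamma> i y) else 0)"
    unfolding other by (intro sum.cong) auto
  also have "\<dots> = y \<bullet> own \<Gamma> i (transpose (cmat \<Gamma> i) *v u i)"
    unfolding sym inner_transpose by simp
  finally show "y \<bullet> own \<Gamma> i (transpose (Lambda \<Gamma>) *v col u) = y \<bullet> own \<Gamma> i (transpose (cmat \<Gamma> i) *v u i)" .
qed

text \<open>Points of the graph over the strategy set lie in the convex epigraph.\<close>

lemma convex_function_section_cost:
  assumes "convex_function (section_cost \<Gamma> i x)" and C: "convex (strat \<Gamma> i)"
  shows "convex_on (strat \<Gamma> i) (\<lambda>y. cost \<Gamma> i (deviate \<Gamma> i y x))"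
  unfolding convex_on_def
proof (intro conjI ballI allI impI C)
  fix y z and u v :: real
  assume yz: "y \<in> strat \<Gamma> i" "z \<in> strat \<Gamma> i" and uv: "0 \<le> u" "0 \<le> v" "u + v = 1"
  let ?f = "\<lambda>y. cost \<Gamma> i (deviate \<Gamma> i y x)" and ?E = "{(y, t::real). section_cost \<Gamma> i x y \<le> ereal t}"
  have "u *\<^sub>R y + v *\<^sub>R z \<in> strat \<Gamma> i" using convexD[OF C yz uv] .
  moreover have "u *\<^sub>R (y, ?f y) + v *\<^sub>R (z, ?f z) \<in> ?E"
    using assms(1) unfolding convex_function_def
    by (rule convexD) (use yz uv in \<open>auto simp: section_cost_def\<close>)
  ultimately show "?f (u *\<^sub>R y + v *\<^sub>R z) \<le> u * ?f y + v * ?f z"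
    by (simp add: section_cost_def)
qed

text \<open>The regularized subgame is built so that its equilibrium condition is the first block of the resolvent
  inclusion: \<open>Rdiag\<close> comes from the proximal terms, \<open>Lambda\<close> from the linear multiplier terms.\<close>

lemma subgame_NE_resolvent:
  assumes reg: "regular_game \<Gamma>" and R: "\<And>i. posdef_on (pspace \<Gamma> i) (R i)"
    and NE: "subgame_NE \<Gamma> R x lam xh"
  shows "Rdiag \<Gamma> R *v (x - xh) - transpose (Lambda \<Gamma>) *v col lam \<in> pseudo_subdiff \<Gamma> xh"
  unfolding mem_pseudo_subdiff_iff[OF regular_strat(1)[OF reg]]
proof (intro conjI allI ballI)
  note strat = regular_strat(1)[OF reg]
  have own_xh: "own \<Gamma> i xh \<in> strat \<Gamma> i" for i
    using NE by (simp add: subgame_NE_def is_arg_min_def)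
  then show "xh \<in> profiles \<Gamma>" by (simp add: profiles_def)
  fix i y assume y: "y \<in> strat \<Gamma> i"
  interpret posdef_form "pspace \<Gamma> i" "(*v) (R i)"
    by (rule posdef_on_form[OF R subspace_pspace])
  let ?f = "\<lambda>y. cost \<Gamma> i (deviate \<Gamma> i y xh)" and ?a = "own \<Gamma> i x" and ?p = "own \<Gamma> i xh"
  let ?l = "transpose (cmat \<Gamma> i) *v lam i"
  let ?g = "Rdiag \<Gamma> R *v (x - xh) - transpose (Lambda \<Gamma>) *v col lam"
  have f: "convex_on (strat \<Gamma> i) ?f"
    using reg own_xh unfolding regular_game_def by (intro convex_function_section_cost) blast+
  have sub: "subgame_cost \<Gamma> R x lam i (deviate \<Gamma> i y xh)
      = ?f y + 1/2 * ((y - ?a) \<bullet> (R i *v (y - ?a))) + ?l \<bullet> y" if "y \<in> strat \<Gamma> i" for y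
    using own_pspace[OF subsetD[OF strat that]]
    by (simp only: subgame_cost_def sqnorm_def own_deviate inner_transpose if_True simp_thms)
  have min: "?f ?p + 1/2 * ((?p - ?a) \<bullet> (R i *v (?p - ?a))) + ?l \<bullet> ?p
      \<le> ?f y + 1/2 * ((y - ?a) \<bullet> (R i *v (y - ?a))) + ?l \<bullet> y" if "y \<in> strat \<Gamma> i" for y
    using NE that unfolding sub[OF that, symmetric] sub[OF own_xh, symmetric]
    by (auto simp: subgame_NE_def is_arg_min_def not_less)
  have "?f ?p + - (R i *v (?p - ?a) + ?l) \<bullet> (y - ?p) \<le> ?f y"
    by (rule minimizer_subgradient[OF regular_strat(2)[OF reg] strat own_in_pspace f own_xh y min])
  moreover have "own \<Gamma> i ?g = own \<Gamma> i (- (R i *v (?p - ?a) + ?l))"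
  proof -
    have "own \<Gamma> i ?g = own \<Gamma> i (R i *v (?a - ?p)) - own \<Gamma> i ?l"
      by (simp only: own_diff Rdiag_mult own_transpose_Lambda)
    also have "\<dots> = own \<Gamma> i (R i *v (?a - ?p) - ?l)" by (simp only: own_diff)
    also have "R i *v (?a - ?p) - ?l = - (R i *v (?p - ?a) + ?l)"
      by (simp only: matrix_vector_mult_diff_distrib) simp
    finally show ?thesis .
  qed
  moreover have "y - ?p \<in> pspace \<Gamma> i"
    using y strat own_in_pspace by (intro subspace_diff subspace_pspace) auto
  ultimately show "cost \<Gamma> i xh + ?g \<bullet> (y - ?p) \<le> cost \<Gamma> i (deviate \<Gamma> i y xh)"
    using inner_own by (metis deviate_own)
qed

text \<open>The matrix \<open>Phi\<close> acting on triples, the space on which \<open>KKT_operator\<close> lives.\<close>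

definition metric ::
  "('p::finite, 'c::finite, 'm::finite) game \<Rightarrow> ('p, 'e::finite) pre_digraph \<Rightarrow>
   ('p \<Rightarrow> real^'c^'c) \<Rightarrow> ('p \<Rightarrow> real^'m^'m) \<Rightarrow> ('e \<Rightarrow> real^'m^'m) \<Rightarrow>
   (real^'c) \<times> (real^('e \<times> 'm)) \<times> (real^('p \<times> 'm)) \<Rightarrow>
   (real^'c) \<times> (real^('e \<times> 'm)) \<times> (real^('p \<times> 'm))" where
  "metric \<Gamma> G R H W = (\<lambda>(x, Z, L).
    (Rdiag \<Gamma> R *v x - transpose (Lambda \<Gamma>) *v L,
     blkdiag (\<lambda>l. matrix_inv (W l)) *v Z - transpose (Vbar G) *v L,
     blkdiag (\<lambda>i. matrix_inv (H i)) *v L - Lambda \<Gamma> *v x - Vbar G *v Z))"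

definition edge_space :: "('p, 'e::finite) pre_digraph \<Rightarrow>
    ((real^'c) \<times> (real^('e \<times> 'm::finite)) \<times> (real^('p \<times> 'm))) set" where
  "edge_space G = {(x, Z, L). \<forall>l r. l \<notin> arcs G \<longrightarrow> Z $ (l, r) = 0}"

definition stack :: "(real^'a) \<times> (real^'b) \<times> (real^'c) \<Rightarrow> real^('a + 'b + 'c)" where
  "stack = (\<lambda>(x, Z, L). \<chi> p. case p of Inl i \<Rightarrow> x $ i | Inr (Inl j) \<Rightarrow> Z $ j | Inr (Inr k) \<Rightarrow> L $ k)"

lemma sum_three:
  fixes f :: "'a::finite + 'b::finite + 'c::finite \<Rightarrow> real"
  shows "sum f UNIV = (\<Sum>i\<in>UNIV. f (Inl i)) + (\<Sum>j\<in>UNIV. f (Inr (Inl j))) + (\<Sum>k\<in>UNIV. f (Inr (Inr k)))"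
  by (simp add: UNIV_Plus_UNIV[symmetric] sum.Plus del: UNIV_Plus_UNIV)

lemma stack_inner: "stack u \<bullet> stack v = u \<bullet> v"
  by (cases u; cases v) (simp add: inner_vec_def sum_three stack_def inner_prod_def)

lemma Phi_stack: "Phi \<Gamma> G R H W *v stack v = stack (metric \<Gamma> G R H W v)"
proof -
  obtain x Z L where v: "v = (x, Z, L)" by (metis prod_cases3)
  have "(Phi \<Gamma> G R H W *v stack v) $ p = stack (metric \<Gamma> G R H W v) $ p" for p
    by (auto simp: v matrix_vector_mult_def sum_three stack_def metric_def Phi_def block3_def
        sum_negf split: sum.split)
  then show ?thesis by (simp add: vec_eq_iff)
qed

lemma metric_posdef_form:
  assumes "posdef_on (Phi_space G) (Phi \<Gamma> G R H W)"
  shows "posdef_form (edge_space G) (metric \<Gamma> G R H W)"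
proof (rule posdef_form.intro)
  show "subspace (edge_space G)"
    by (auto simp: subspace_def edge_space_def zero_prod_def)
  show "linear (metric \<Gamma> G R H W)"
    by (intro linearI)
       (auto simp: metric_def matrix_vector_right_distrib matrix_vector_mult_scaleR scaleR_diff_right
         simp del: transpose_matrix_vector)
  have stack_mem: "stack u \<in> Phi_space G" if "u \<in> edge_space G" for u
    using that by (cases u) (auto simp: edge_space_def Phi_space_def stack_def)
  show "u \<bullet> metric \<Gamma> G R H W v = metric \<Gamma> G R H W u \<bullet> v"
    if "u \<in> edge_space G" "v \<in> edge_space G" for u v
    using assms stack_mem[OF that(1)] stack_mem[OF that(2)]
    unfolding posdef_on_def stack_inner[symmetric] Phi_stack[symmetric] by blast
  show "0 < v \<bullet> metric \<Gamma> G R H W v" if "v \<in> edge_space G" "v \<noteq> 0" for v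
  proof -
    have "stack v \<noteq> 0" using stack_inner[of v v] that(2) by auto
    then show ?thesis
      using assms stack_mem[OF that(1)]
      unfolding posdef_on_def stack_inner[symmetric] Phi_stack[symmetric] by blast
  qed
qed

lemma edge_col_in_edge_space: "(x, edge_col G z, L) \<in> edge_space G"
  by (simp add: edge_space_def edge_col_def col_nth)

lemma Vbar_edge_col:
  "Vbar G *v edge_col G y = col (\<lambda>i. \<Sum>l\<in>in_arcs G i \<union> out_arcs G i. incidence G $ i $ l *\<^sub>R y l)"
proof -
  have "(Vbar G *v edge_col G y) $ (i, r) = (\<Sum>l\<in>in_arcs G i \<union> out_arcs G i. incidence G $ i $ l * y l $ r)" for i r
    unfolding Vbar_mult
    by (rule sum.mono_neutral_cong_right)
       (auto simp: edge_col_def col_nth incidence_def in_arcs_def out_arcs_def)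
  then show ?thesis by (auto simp: vec_eq_iff col_nth)
qed

lemma edge_col_diff: "edge_col G (\<lambda>l. u l - v l) = edge_col G u - edge_col G v"
  by (auto simp: edge_col_def col_def vec_eq_iff)

lemma edge_col_scale: "edge_col G (\<lambda>l. a *\<^sub>R u l) = a *\<^sub>R edge_col G u"
  by (auto simp: edge_col_def col_def vec_eq_iff)

lemma col_normal_cone_orthant:
  assumes "\<And>i. w i \<in> normal_cone orthant (u i)"
  shows "col w \<in> normal_cone orthant (col u)"
  using assms unfolding normal_cone_orthant_iff
  by (auto simp: less_eq_vec_def col_nth inner_col)

lemma norm_col_le: "norm (col u) \<le> (\<Sum>i\<in>UNIV. norm (u i))"
proof -
  have "(norm (col u))\<^sup>2 = (\<Sum>i\<in>UNIV. (norm (u i))\<^sup>2)"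
    by (simp add: power2_norm_eq_inner inner_col)
  also have "\<dots> = (L2_set (\<lambda>i. norm (u i)) UNIV)\<^sup>2"
    by (simp add: L2_set_def sum_nonneg)
  finally have "norm (col u) = L2_set (\<lambda>i. norm (u i)) UNIV"
    by (simp add: L2_set_nonneg)
  then show ?thesis using L2_set_le_sum[of UNIV "\<lambda>i. norm (u i)"] by simp
qed

text \<open>The point \<open>v\<close> consists of the exact subgame equilibrium, the edge variables of the algorithm before
  relaxation, and the multipliers that the projection formula would give for the exact equilibrium.  The
  constant \<open>K\<close> collects the Lipschitz constants of the projections and of the maps that enter them.\<close>

lemma algorithm_step_resolvent:
  fixes \<Gamma> :: "('p::finite, 'c::finite, 'm::finite) game"
    and G :: "('p, 'e::finite) pre_digraph"
  assumes reg: "regular_game \<Gamma>" and G: "oriented_graph G" and rho: "0 \<le> \<rho>"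
    and par: "admissible_parameters \<Gamma> G R H W"
  obtains K where "\<And>\<mu> x z lam x' z' lam'. algorithm_step \<Gamma> G R H W \<rho> \<mu> x z lam x' z' lam' \<Longrightarrow>
    \<exists>v\<in>edge_space G. metric \<Gamma> G R H W ((x, edge_col G z, col lam) - v) \<in> KKT_operator \<Gamma> G v \<and>
      norm ((x', edge_col G z', col lam') -
        ((x, edge_col G z, col lam) + \<rho> *\<^sub>R (v - (x, edge_col G z, col lam)))) \<le> K * \<mu>"
proof -
  note strat = regular_strat(1)[OF reg]
  have R: "\<And>i. posdef_on (pspace \<Gamma> i) (R i)" and H: "\<And>i. posdef_on UNIV (H i)"
    and W: "\<And>l. l \<in> arcs G \<Longrightarrow> posdef_on UNIV (W l)"
    using par by (auto simp: admissible_parameters_def)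
  define P where "P i v = projection (matrix_inv (H i)) orthant v" for i v
  (* The effect on the argument of the projection of player i when the equilibrium moves by d. *)
  define D where "D i d = H i *v (cmat \<Gamma> i *v own \<Gamma> i (2 *\<^sub>R d))" for i d
  have lin: "linear (D i)" for i
    by (intro linearI)
       (simp_all add: D_def own_add own_scale matrix_vector_right_distrib matrix_vector_mult_scaleR scaleR_add_right)
  have Hinv: "posdef_on UNIV (matrix_inv (H i))" for i using posdef_inverse(3)[OF H] .
  have orth: "orthant \<noteq> ({} :: (real^'m) set)" using zero_in_orthant by blast
  have "\<exists>k\<ge>0. \<forall>u v. norm (P i u - P i v) \<le> k * norm (u - v)" for i
    using projection_lipschitz[OF Hinv closed_orthant convex_orthant orth, of i] unfolding P_def by metis
  then obtain k where k: "\<And>i. 0 \<le> k i" "\<And>i u v. norm (P i u - P i v) \<le> k i * norm (u - v)" by metis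
  have "\<exists>B>0. \<forall>d. norm (D i d) \<le> B * norm d" for i
    using linear_bounded_pos[OF lin[of i]] by metis
  then obtain B where B: "\<And>i. 0 < B i" "\<And>i d. norm (D i d) \<le> B i * norm d" by metis
  define K where "K = \<rho> * (1 + (\<Sum>i\<in>UNIV. k i * B i))"
  show thesis
  proof (rule that[of K])
    fix \<mu> x z lam x' z' lam'
    assume "algorithm_step \<Gamma> G R H W \<rho> \<mu> x z lam x' z' lam'"
    then obtain xh xt zt lamt where NE: "subgame_NE \<Gamma> R x lam xh" and xt: "norm (xt - xh) \<le> \<mu>"
      and x': "x' = x + \<rho> *\<^sub>R (xt - x)"
      and zt: "\<And>l. l \<in> arcs G \<Longrightarrow> zt l = z l - W l *v (lam (head G l) - lam (tail G l))"
      and z': "\<And>l. l \<in> arcs G \<Longrightarrow> z' l = z l + \<rho> *\<^sub>R (zt l - z l)"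
      and lamt: "\<And>i. lamt i = P i (lam i + H i *v (cmat \<Gamma> i *v own \<Gamma> i (2 *\<^sub>R xt - x)
          + (\<Sum>l\<in>in_arcs G i \<union> out_arcs G i. incidence G $ i $ l *\<^sub>R (2 *\<^sub>R zt l - z l)) - cvec \<Gamma> i))"
      and lam': "\<And>i. lam' i = lam i + \<rho> *\<^sub>R (lamt i - lam i)"
      unfolding algorithm_step_def P_def by blast
    define S where "S i = (\<Sum>l\<in>in_arcs G i \<union> out_arcs G i. incidence G $ i $ l *\<^sub>R (2 *\<^sub>R zt l - z l))" for i
    define d where "d y i = cmat \<Gamma> i *v own \<Gamma> i (2 *\<^sub>R y - x) + S i - cvec \<Gamma> i" for y i
    define lamh where "lamh i = P i (lam i + H i *v d xh i)" for i
    have lamt: "lamt i = P i (lam i + H i *v d xt i)" for i unfolding lamt d_def S_def ..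
    let ?Z = "edge_col G z" and ?Zt = "edge_col G zt" and ?L = "col lam" and ?Lh = "col lamh"
    let ?w = "(x, ?Z, ?L)" and ?v = "(xh, ?Zt, ?Lh)"
    have "metric \<Gamma> G R H W (?w - ?v) \<in> KKT_operator \<Gamma> G ?v"
    proof -
      have 1: "Rdiag \<Gamma> R *v (x - xh) - transpose (Lambda \<Gamma>) *v (?L - ?Lh) - transpose (Lambda \<Gamma>) *v ?Lh
          \<in> pseudo_subdiff \<Gamma> xh"
        using subgame_NE_resolvent[OF reg R NE]
        by (simp only: matrix_vector_mult_diff_distrib[of "transpose _"] diff_diff_eq diff_add_cancel)
      have "blkdiag (\<lambda>l. matrix_inv (W l)) *v (?Z - ?Zt) = transpose (Vbar G) *v ?L"
      proof -
        have "(blkdiag (\<lambda>l. matrix_inv (W l)) *v (?Z - ?Zt)) $ (l, r) = (transpose (Vbar G) *v ?L) $ (l, r)" for l r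
          unfolding edge_col_diff[symmetric] unfolding edge_col_def blkdiag_mult transpose_Vbar_mult[OF G]
          using zt posdef_inverse(2)[OF W] by (simp add: col_nth)
        then show ?thesis by (auto simp: vec_eq_iff)
      qed
      then have 2: "blkdiag (\<lambda>l. matrix_inv (W l)) *v (?Z - ?Zt) - transpose (Vbar G) *v (?L - ?Lh)
          = transpose (Vbar G) *v ?Lh"
        by (simp only: matrix_vector_mult_diff_distrib) simp
      (* The optimality condition of the projection, with the step H d turned into d by the metric. *)
      have eq: "matrix_inv (H i) *v (lam i + H i *v d xh i - lamh i)
          = matrix_inv (H i) *v (lam i - lamh i) + d xh i" for i
        using posdef_inverse(2)[OF H[of i], of "d xh i"]
        by (simp only: matrix_vector_mult_diff_distrib matrix_vector_right_distrib) simp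
      have "col (\<lambda>i. matrix_inv (H i) *v (lam i - lamh i) + d xh i) \<in> normal_cone orthant ?Lh"
      proof (rule col_normal_cone_orthant)
        fix i show "matrix_inv (H i) *v (lam i - lamh i) + d xh i \<in> normal_cone orthant (lamh i)"
          using projection_normal_cone[OF Hinv closed_orthant convex_orthant orth, of i "lam i + H i *v d xh i"]
          unfolding P_def[symmetric] lamh_def[symmetric] eq .
      qed
      moreover have "col (\<lambda>i. matrix_inv (H i) *v (lam i - lamh i) + d xh i)
          = blkdiag (\<lambda>i. matrix_inv (H i)) *v (?L - ?Lh)
            + (Lambda \<Gamma> *v (2 *\<^sub>R xh - x) + Vbar G *v (2 *\<^sub>R ?Zt - ?Z) - col (cvec \<Gamma>))"
        unfolding d_def S_def edge_col_scale[symmetric] edge_col_diff[symmetric] col_diff[symmetric]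
          Vbar_edge_col blkdiag_mult Lambda_mult col_add[symmetric] ..
      moreover have "\<dots> = blkdiag (\<lambda>i. matrix_inv (H i)) *v (?L - ?Lh) - Lambda \<Gamma> *v (x - xh) - Vbar G *v (?Z - ?Zt)
            + Lambda \<Gamma> *v xh + Vbar G *v ?Zt - col (cvec \<Gamma>)"
        unfolding matrix_vector_mult_diff_distrib matrix_vector_mult_scaleR
        by (simp only: scaleR_2 diff_conv_add_uminus minus_add_distrib minus_minus ac_simps)
      ultimately have 3: "blkdiag (\<lambda>i. matrix_inv (H i)) *v (?L - ?Lh) - Lambda \<Gamma> *v (x - xh) - Vbar G *v (?Z - ?Zt)
            + Lambda \<Gamma> *v xh + Vbar G *v ?Zt - col (cvec \<Gamma>) \<in> normal_cone orthant ?Lh"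
        by simp
      show ?thesis
        unfolding metric_def diff_Pair prod.case mem_KKT_operator_iff[OF strat] using 1 2 3 by blast
    qed
    moreover have "norm ((x', edge_col G z', col lam') - (?w + \<rho> *\<^sub>R (?v - ?w))) \<le> K * \<mu>"
    proof -
      have "edge_col G z' = ?Z + \<rho> *\<^sub>R (?Zt - ?Z)"
        unfolding edge_col_diff[symmetric] edge_col_scale[symmetric]
        by (auto simp: edge_col_def col_def vec_eq_iff z')
      moreover have "x' - (x + \<rho> *\<^sub>R (xh - x)) = \<rho> *\<^sub>R (xt - xh)"
        by (simp add: x' scaleR_diff_right)
      moreover have "col lam' - (?L + \<rho> *\<^sub>R (?Lh - ?L)) = \<rho> *\<^sub>R col (\<lambda>i. lamt i - lamh i)"
        by (simp add: lam' col_def vec_eq_iff algebra_simps)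
      ultimately have "(x', edge_col G z', col lam') - (?w + \<rho> *\<^sub>R (?v - ?w))
          = \<rho> *\<^sub>R (xt - xh, 0, col (\<lambda>i. lamt i - lamh i))"
        by simp
      then have "norm ((x', edge_col G z', col lam') - (?w + \<rho> *\<^sub>R (?v - ?w)))
          = \<rho> * norm (xt - xh, 0 :: real^('e \<times> 'm), col (\<lambda>i. lamt i - lamh i))"
        using rho by (simp only: norm_scaleR abs_of_nonneg)
      also have "\<dots> \<le> \<rho> * (norm (xt - xh) + norm (col (\<lambda>i. lamt i - lamh i)))"
        using rho norm_Pair_le[of "xt - xh" "(0 :: real^('e \<times> 'm), col (\<lambda>i. lamt i - lamh i))"]
        by (intro mult_left_mono) (simp_all add: norm_Pair)
      also have "\<dots> \<le> \<rho> * (\<mu> + (\<Sum>i\<in>UNIV. k i * B i * \<mu>))"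
      proof (intro mult_left_mono add_mono xt rho, rule order_trans[OF norm_col_le sum_mono])
        fix i
        have "H i *v d xt i - H i *v d xh i = D i (xt - xh)"
          by (simp add: d_def D_def own_diff own_scale matrix_vector_mult_diff_distrib
              matrix_vector_right_distrib scaleR_diff_right)
        then have "norm (lamt i - lamh i) \<le> k i * norm (D i (xt - xh))"
          using k(2)[of i "lam i + H i *v d xt i" "lam i + H i *v d xh i"] by (simp add: lamt lamh_def)
        also have "\<dots> \<le> k i * (B i * norm (xt - xh))" by (intro mult_left_mono k B)
        also have "\<dots> \<le> k i * (B i * \<mu>)"
          using k(1)[of i] B(1)[of i] xt by (intro mult_left_mono) auto
        finally show "norm (lamt i - lamh i) \<le> k i * B i * \<mu>" by (simp only: mult.assoc)
      qed
      also have "\<dots> = K * \<mu>"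
        unfolding K_def sum_distrib_right[symmetric] by (simp add: algebra_simps)
      finally show ?thesis .
    qed
    ultimately show "\<exists>v\<in>edge_space G. metric \<Gamma> G R H W (?w - v) \<in> KKT_operator \<Gamma> G v \<and>
        norm ((x', edge_col G z', col lam') - (?w + \<rho> *\<^sub>R (v - ?w))) \<le> K * \<mu>"
      using edge_col_in_edge_space by blast
  qed
qed

section \<open>Convergence of the algorithm\<close>

theorem theorem6:
  fixes \<Gamma> :: "('p::finite, 'c::finite, 'm::finite) game"
    and G :: "('p, 'e::finite) pre_digraph"
    and R :: "'p \<Rightarrow> real^'c^'c" and H :: "'p \<Rightarrow> real^'m^'m" and W :: "'e \<Rightarrow> real^'m^'m"
    and \<rho> :: real and \<mu> :: "nat \<Rightarrow> real"
    and x :: "nat \<Rightarrow> real^'c" and z :: "nat \<Rightarrow> 'e \<Rightarrow> real^'m" and lam :: "nat \<Rightarrow> 'p \<Rightarrow> real^'m"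
  assumes "regular_game \<Gamma>"
    and "\<exists>v. GVI_solution \<Gamma> v"
    and "oriented_graph G" and "Digraph_Component.connected G"
    and "1 \<le> \<rho>" and "\<rho> < 2"
    and "\<And>k. 0 \<le> \<mu> k" and "summable \<mu>"
    and "admissible_parameters \<Gamma> G R H W"
    and "\<And>k. algorithm_step \<Gamma> G R H W \<rho> (\<mu> k) (x k) (z k) (lam k)
                (x (Suc k)) (z (Suc k)) (lam (Suc k))"
  shows "\<exists>xs Zs Ls.
      (\<lambda>k. (x k, edge_col G (z k), col (lam k))) \<longlonglongrightarrow> (xs, Zs, Ls) \<and>
      (xs, Zs, Ls) \<in> zer (KKT_operator \<Gamma> G) \<and>
      variational_GNE \<Gamma> xs \<and>
      (\<exists>l. l \<in> orthant \<and> Ls = kron_vec (\<chi> i. 1) l)"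
proof -
  note reg = assms(1) and G = assms(3,4)
  note strat = regular_strat(1)[OF reg]
  have max: "maximally_monotone (pseudo_subdiff \<Gamma>)" using reg by (simp add: regular_game_def)
  then have mono: "monotone_operator (KKT_operator \<Gamma> G)"
    by (intro KKT_operator_monotone strat) (simp add: maximally_monotone_def)
  interpret posdef_form "edge_space G" "metric \<Gamma> G R H W"
    using assms(9) by (intro metric_posdef_form) (simp add: admissible_parameters_def)
  obtain y where "GVI_solution \<Gamma> y" using assms(2) by blast
  then obtain z0 L0 where zero: "(y, edge_col G z0, L0) \<in> zer (KKT_operator \<Gamma> G)"
    using GVI_solution_imp_zer_KKT[OF reg G] by blast
  define w where "w k = (x k, edge_col G (z k), col (lam k))" for k
  have w_in: "w k \<in> edge_space G" for k by (simp only: w_def edge_col_in_edge_space)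
  have rho: "0 \<le> \<rho>" "0 < \<rho>" using assms(5) by simp_all
  obtain K where K: "\<And>\<mu> x z lam x' z' lam'. algorithm_step \<Gamma> G R H W \<rho> \<mu> x z lam x' z' lam' \<Longrightarrow>
    \<exists>v\<in>edge_space G. metric \<Gamma> G R H W ((x, edge_col G z, col lam) - v) \<in> KKT_operator \<Gamma> G v \<and>
      norm ((x', edge_col G z', col lam') -
        ((x, edge_col G z, col lam) + \<rho> *\<^sub>R (v - (x, edge_col G z, col lam)))) \<le> K * \<mu>"
    using algorithm_step_resolvent[OF reg G(1) rho(1) assms(9)] by metis
  have "\<exists>v. v \<in> edge_space G \<and> metric \<Gamma> G R H W (w k - v) \<in> KKT_operator \<Gamma> G v \<and>
      norm (w (Suc k) - (w k + \<rho> *\<^sub>R (v - w k))) \<le> K * \<mu> k" for k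
    using K[OF assms(10)[of k]] unfolding w_def by blast
  then obtain v where v: "\<And>k. v k \<in> edge_space G"
      "\<And>k. metric \<Gamma> G R H W (w k - v k) \<in> KKT_operator \<Gamma> G (v k)"
      "\<And>k. norm (w (Suc k) - (w k + \<rho> *\<^sub>R (v k - w k))) \<le> K * \<mu> k"
    by metis
  have "\<exists>p \<in> zer (KKT_operator \<Gamma> G). w \<longlonglongrightarrow> p"
  proof (rule relaxed_proximal_point_convergence[OF mono zero edge_col_in_edge_space _ w_in v
        summable_mult[OF assms(8)] rho(2) assms(6)])
    fix v u p assume "\<And>k. u k \<in> KKT_operator \<Gamma> G (v k)" "v \<longlonglongrightarrow> p" "u \<longlonglongrightarrow> 0"
    then show "p \<in> zer (KKT_operator \<Gamma> G)"
      unfolding zer_def using KKT_operator_closed[OF strat max] by blast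
  qed
  then obtain xs Zs Ls where lim: "w \<longlonglongrightarrow> (xs, Zs, Ls)" and zer: "(xs, Zs, Ls) \<in> zer (KKT_operator \<Gamma> G)"
    by (metis prod_cases3)
  note sol = zer_KKT_imp_GVI_solution[OF strat G zer]
  have "variational_GNE \<Gamma> xs"
    using sol(1) GVI_solution_imp_GNE[OF strat] by (simp add: variational_GNE_def)
  then show ?thesis using lim zer sol(2) unfolding w_def by blast
qed

end
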